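(* Let $H=B(n,w,\gamma)$. (1) Every simple Yetter-Drinfeld module over $H$ is isomorphic to $V(\alpha,\beta,x^rg^i)$ for some scalars $\alpha,\beta\in\Bbbk^*$ and integers $r,i\in\mathbb{Z}$ satisfying $\alpha^w=\beta^n$. (2) Two such modules $V(\alpha,\beta,x^rg^i)$ and $V(\alpha',\beta',x^{r'}g^{i'})$ are isomorphic if and only if $\alpha=\alpha'$, $\beta=\beta'$ and $x^rg^i=x^{r'}g^{i'}$ in $H$.
   Context: $\Bbbk$ is an algebraically closed field of characteristic $0$; $n,w$ are positive integers and $\gamma\in\Bbbk$ is a primitive $n$-th root of unity. The generalized Liu algebra $H=B(n,w,\gamma)$ is the Hopf algebra generated by $x^{\pm1},g,y$ with relations $xx^{-1}=x^{-1}x=1$, $xg=gx$, $xy=yx$, $yg=\gamma gy$, $y^n=1-x^w=1-g^n$, with $\Delta(x)=x\otimes x$, $\Delta(g)=g\otimes g$, $\Delta(y)=y\otimes g+1\otimes y$, $\varepsilon(x)=\varepsilon(g)=1$, $\varepsilon(y)=0$, $S(x)=x^{-1}$, $S(g)=g^{-1}$, $S(y)=-yg^{-1}$. A (left-left) Yetter-Drinfeld module over $H$ is a left $H$-module and left $H$-comodule $(V,\cdot,\delta)$, $\delta(v)=v_{(-1)}\otimes v_{(0)}$, with $\delta(h\cdot v)=h_{(1)}v_{(-1)}S(h_{(3)})\otimes h_{(2)}\cdot v_{(0)}$; it is simple if it has no nonzero proper Yetter-Drinfeld submodules. For $\beta\in\Bbbk^*$ and $r,i\in\mathbb{Z}$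 define elements $c_\beta^{r,i}(k,l)\in H$ ($0\le l\le k$) recursively: $c_\beta^{r,i}(0,0)=x^rg^i$, and for $k\ge0$: $c_\beta^{r,i}(k+1,0)=c_\beta^{r,i}(k,0)S(y)+\beta y c_\beta^{r,i}(k,0)S(g)$; for $0<l<k+1$, $c_\beta^{r,i}(k+1,l)=c_\beta^{r,i}(k,l)S(y)+\beta\gamma^{-l}y c_\beta^{r,i}(k,l)S(g)+c_\beta^{r,i}(k,l-1)S(g)$; $c_\beta^{r,i}(k+1,k+1)=c_\beta^{r,i}(k,k)S(g)$. For $i\in\mathbb{Z}$ let $\phi(i)$ be the unique integer in $\{1,\dots,n\}$ with $i\equiv\phi(i)\pmod n$. For $\alpha,\beta\in\Bbbk^*$, $r,i\in\mathbb{Z}$ with $\alpha^w=\beta^n$, the module $V(\alpha,\beta,x^rg^i)$ has basis $v_0,\dots,v_m$ where $m=n-\phi(-i-j)$ if $\beta=\gamma^j$ for some $j\in\mathbb{Z}$, and $m=n-1$ if $\beta^n\ne1$; the structure is $x\cdot v_k=\alpha v_k$, $g\cdot v_k=\beta\gamma^{-k}v_k$, $y\cdot v_k=v_{k+1}$ for $0\le k<m$, $y\cdot v_m=(1-\beta^n)v_0$, and $\delta(v_k)=\sum_{l=0}^k c_\beta^{r,i}(k,l)\otimes v_l$. *)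

theory Defs
  imports Main "HOL-Library.Poly_Mapping" "HOL-Computational_Algebra.Polynomial"
begin

text \<open>Conventions. The Hopf algebra H = B(n,w,gamma) is modelled concretely by its PBW basis
  x^r g^i y^j with r an integer and 0 <= i, j < n. A basis index is a triple (r,i,j);
  an element of H is a finitely supported function from indices to the field;
  H tensor H is modelled with pairs of indices, H tensor H tensor H with triples,
  and H tensor V (V any vector space) as finitely supported V-valued functions on indices.\<close>

type_synonym bidx = "int \<times> nat \<times> nat"
type_synonym 'k hel = "bidx \<Rightarrow>\<^sub>0 'k"

definition alg_closed :: "'k::field itself \<Rightarrow> bool" where
  "alg_closed _ \<longleftrightarrow> (\<forall>p::'k poly. degree p > 0 \<longrightarrow> (\<exists>z. poly p z = 0))"

definition primitive_root :: "nat \<Rightarrow> 'k::field \<Rightarrow> bool" where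
  "primitive_root n \<gamma> \<longleftrightarrow> \<gamma> ^ n = 1 \<and> (\<forall>m. 0 < m \<and> m < n \<longrightarrow> \<gamma> ^ m \<noteq> 1)"

definition psc :: "'k::semiring_0 \<Rightarrow> ('a \<Rightarrow>\<^sub>0 'k) \<Rightarrow> ('a \<Rightarrow>\<^sub>0 'k)" where
  "psc c a = Poly_Mapping.map (\<lambda>z. c * z) a"

definition pmapV :: "('v::zero \<Rightarrow> 'u::comm_monoid_add) \<Rightarrow> ('a \<Rightarrow>\<^sub>0 'v) \<Rightarrow> ('a \<Rightarrow>\<^sub>0 'u)" where
  "pmapV f t = (\<Sum>b\<in>Poly_Mapping.keys t. Poly_Mapping.single b (f (Poly_Mapping.lookup t b)))"

definition tensV :: "('k::zero \<Rightarrow> 'v \<Rightarrow> 'v::comm_monoid_add) \<Rightarrow> ('a \<Rightarrow>\<^sub>0 'k) \<Rightarrow> 'v \<Rightarrow> ('a \<Rightarrow>\<^sub>0 'v)" where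
  "tensV sc a u = (\<Sum>b\<in>Poly_Mapping.keys a. Poly_Mapping.single b (sc (Poly_Mapping.lookup a b) u))"

definition bas :: "bidx \<Rightarrow> 'k::{zero,one} hel" where
  "bas b = Poly_Mapping.single b 1"

locale Bnwg =
  fixes n w :: nat and \<gamma> :: "'k::field"
begin

definition valid :: "bidx \<Rightarrow> bool" where
  "valid b \<longleftrightarrow> fst (snd b) < n \<and> snd (snd b) < n"

definition Hcar :: "'k hel set" where
  "Hcar = {h. Poly_Mapping.keys h \<subseteq> {b. valid b}}"

text \<open>normal form of the monomial x^a g^b y^c (a, b integers, c natural), using
  g^n = x^w and y^n = 1 - x^w (which is central)\<close>
definition mono :: "int \<Rightarrow> int \<Rightarrow> nat \<Rightarrow> 'k hel" where
  "mono a b c = (\<Sum>t\<in>{..c div n}.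
     Poly_Mapping.single (a + int w * (b div int n) + int w * int t, nat (b mod int n), c mod n)
       ((-1) ^ t * of_nat ((c div n) choose t)))"

definition hone :: "'k hel" where "hone = mono 0 0 0"
definition hx :: "'k hel" where "hx = mono 1 0 0"
definition hxinv :: "'k hel" where "hxinv = mono (-1) 0 0"
definition hg :: "'k hel" where "hg = mono 0 1 0"
definition hy :: "'k hel" where "hy = mono 0 0 1"

definition bmul :: "bidx \<Rightarrow> bidx \<Rightarrow> 'k hel" where
  "bmul p q = (case p of (r, i, j) \<Rightarrow> case q of (s, l, m) \<Rightarrow>
      psc (\<gamma> ^ (j * l)) (mono (r + s) (int i + int l) (j + m)))"

definition hmul :: "'k hel \<Rightarrow> 'k hel \<Rightarrow> 'k hel" where
  "hmul a b = (\<Sum>p\<in>Poly_Mapping.keys a. \<Sum>q\<in>Poly_Mapping.keys b. psc (Poly_Mapping.lookup a p * Poly_Mapping.lookup b q) (bmul p q))"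

primrec hpow :: "'k hel \<Rightarrow> nat \<Rightarrow> 'k hel" where
  "hpow a 0 = hone"
| "hpow a (Suc k) = hmul a (hpow a k)"

definition tens :: "'k hel \<Rightarrow> 'k hel \<Rightarrow> (bidx \<times> bidx) \<Rightarrow>\<^sub>0 'k" where
  "tens a b = (\<Sum>p\<in>Poly_Mapping.keys a. \<Sum>q\<in>Poly_Mapping.keys b. Poly_Mapping.single (p, q) (Poly_Mapping.lookup a p * Poly_Mapping.lookup b q))"

definition tmul :: "((bidx \<times> bidx) \<Rightarrow>\<^sub>0 'k) \<Rightarrow> ((bidx \<times> bidx) \<Rightarrow>\<^sub>0 'k) \<Rightarrow> ((bidx \<times> bidx) \<Rightarrow>\<^sub>0 'k)" where
  "tmul A B = (\<Sum>P\<in>Poly_Mapping.keys A. \<Sum>Q\<in>Poly_Mapping.keys B.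
      psc (Poly_Mapping.lookup A P * Poly_Mapping.lookup B Q) (tens (bmul (fst P) (fst Q)) (bmul (snd P) (snd Q))))"

primrec tpow :: "((bidx \<times> bidx) \<Rightarrow>\<^sub>0 'k) \<Rightarrow> nat \<Rightarrow> ((bidx \<times> bidx) \<Rightarrow>\<^sub>0 'k)" where
  "tpow A 0 = tens hone hone"
| "tpow A (Suc k) = tmul A (tpow A k)"

text \<open>coproduct: the algebra map with Delta(x) = x tensor x, Delta(g) = g tensor g,
  Delta(y) = y tensor g + 1 tensor y (hence Delta(x^-1) = x^-1 tensor x^-1)\<close>
definition Dbasis :: "bidx \<Rightarrow> (bidx \<times> bidx) \<Rightarrow>\<^sub>0 'k" where
  "Dbasis b = (case b of (r, i, j) \<Rightarrow>
     tmul (if r \<ge> 0 then tpow (tens hx hx) (nat r) else tpow (tens hxinv hxinv) (nat (- r)))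
       (tmul (tpow (tens hg hg) i) (tpow (tens hy hg + tens hone hy) j)))"

definition hDelta :: "'k hel \<Rightarrow> (bidx \<times> bidx) \<Rightarrow>\<^sub>0 'k" where
  "hDelta h = (\<Sum>b\<in>Poly_Mapping.keys h. psc (Poly_Mapping.lookup h b) (Dbasis b))"

definition hDelta2 :: "'k hel \<Rightarrow> (bidx \<times> bidx \<times> bidx) \<Rightarrow>\<^sub>0 'k" where
  "hDelta2 h = (\<Sum>P\<in>Poly_Mapping.keys (hDelta h). \<Sum>Q\<in>Poly_Mapping.keys (Dbasis (fst P)).
      Poly_Mapping.single (fst Q, snd Q, snd P) (Poly_Mapping.lookup (hDelta h) P * Poly_Mapping.lookup (Dbasis (fst P)) Q))"

definition beps :: "bidx \<Rightarrow> 'k" where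
  "beps b = (if snd (snd b) = 0 then 1 else 0)"

text \<open>antipode: the anti-algebra map with S(x) = x^-1, S(g) = g^-1, S(y) = - y g^-1\<close>
definition Sg :: "'k hel" where "Sg = mono 0 (-1) 0"
definition Sy :: "'k hel" where "Sy = psc (-1) (hmul hy Sg)"

definition Sbasis :: "bidx \<Rightarrow> 'k hel" where
  "Sbasis b = (case b of (r, i, j) \<Rightarrow>
     hmul (hpow Sy j) (hmul (hpow Sg i)
       (if r \<ge> 0 then hpow hxinv (nat r) else hpow hx (nat (- r)))))"

definition is_YD :: "('k \<Rightarrow> 'v \<Rightarrow> 'v::ab_group_add) \<Rightarrow> 'v set \<Rightarrow> ('k hel \<Rightarrow> 'v \<Rightarrow> 'v)
    \<Rightarrow> ('v \<Rightarrow> bidx \<Rightarrow>\<^sub>0 'v) \<Rightarrow> bool" where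
  "is_YD sc V act \<delta> \<longleftrightarrow>
     vector_space sc \<and> module.subspace sc V \<and>
     \<comment> \<open>left H-module\<close>
     (\<forall>h\<in>Hcar. \<forall>v\<in>V. act h v \<in> V) \<and>
     (\<forall>h\<in>Hcar. \<forall>u\<in>V. \<forall>v\<in>V. act h (u + v) = act h u + act h v) \<and>
     (\<forall>h\<in>Hcar. \<forall>c. \<forall>v\<in>V. act h (sc c v) = sc c (act h v)) \<and>
     (\<forall>a\<in>Hcar. \<forall>b\<in>Hcar. \<forall>v\<in>V. act (a + b) v = act a v + act b v) \<and>
     (\<forall>a\<in>Hcar. \<forall>c. \<forall>v\<in>V. act (psc c a) v = sc c (act a v)) \<and>
     (\<forall>a\<in>Hcar. \<forall>b\<in>Hcar. \<forall>v\<in>V. act (hmul a b) v = act a (act b v)) \<and>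
     (\<forall>v\<in>V. act hone v = v) \<and>
     \<comment> \<open>left H-comodule\<close>
     (\<forall>v\<in>V. Poly_Mapping.keys (\<delta> v) \<subseteq> {b. valid b} \<and> (\<forall>b. Poly_Mapping.lookup (\<delta> v) b \<in> V)) \<and>
     (\<forall>u\<in>V. \<forall>v\<in>V. \<delta> (u + v) = \<delta> u + \<delta> v) \<and>
     (\<forall>c. \<forall>v\<in>V. \<delta> (sc c v) = pmapV (sc c) (\<delta> v)) \<and>
     (\<forall>v\<in>V. (\<Sum>b\<in>Poly_Mapping.keys (\<delta> v). sc (beps b) (Poly_Mapping.lookup (\<delta> v) b)) = v) \<and>
     (\<forall>v\<in>V. (\<Sum>b\<in>Poly_Mapping.keys (\<delta> v). \<Sum>Q\<in>Poly_Mapping.keys (Dbasis b).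
                 Poly_Mapping.single Q (sc (Poly_Mapping.lookup (Dbasis b) Q) (Poly_Mapping.lookup (\<delta> v) b)))
           = (\<Sum>b\<in>Poly_Mapping.keys (\<delta> v). \<Sum>q\<in>Poly_Mapping.keys (\<delta> (Poly_Mapping.lookup (\<delta> v) b)).
                 Poly_Mapping.single (b, q) (Poly_Mapping.lookup (\<delta> (Poly_Mapping.lookup (\<delta> v) b)) q))) \<and>
     \<comment> \<open>Yetter-Drinfeld compatibility: delta(h.v) = h1 v(-1) S(h3) tensor h2.v(0)\<close>
     (\<forall>h\<in>Hcar. \<forall>v\<in>V. \<delta> (act h v) =
        (\<Sum>T\<in>Poly_Mapping.keys (hDelta2 h). \<Sum>b\<in>Poly_Mapping.keys (\<delta> v).
           tensV sc (psc (Poly_Mapping.lookup (hDelta2 h) T) (hmul (bas (fst T)) (hmul (bas b) (Sbasis (snd (snd T))))))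
                 (act (bas (fst (snd T))) (Poly_Mapping.lookup (\<delta> v) b))))"

definition is_YD_sub :: "('k \<Rightarrow> 'v \<Rightarrow> 'v::ab_group_add) \<Rightarrow> 'v set \<Rightarrow> ('k hel \<Rightarrow> 'v \<Rightarrow> 'v)
    \<Rightarrow> ('v \<Rightarrow> bidx \<Rightarrow>\<^sub>0 'v) \<Rightarrow> 'v set \<Rightarrow> bool" where
  "is_YD_sub sc V act \<delta> W \<longleftrightarrow> W \<subseteq> V \<and> module.subspace sc W \<and>
     (\<forall>h\<in>Hcar. \<forall>u\<in>W. act h u \<in> W) \<and> (\<forall>u\<in>W. \<forall>b. Poly_Mapping.lookup (\<delta> u) b \<in> W)"

definition is_simple_YD :: "('k \<Rightarrow> 'v \<Rightarrow> 'v::ab_group_add) \<Rightarrow> 'v set \<Rightarrow> ('k hel \<Rightarrow> 'v \<Rightarrow> 'v)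
    \<Rightarrow> ('v \<Rightarrow> bidx \<Rightarrow>\<^sub>0 'v) \<Rightarrow> bool" where
  "is_simple_YD sc V act \<delta> \<longleftrightarrow> is_YD sc V act \<delta> \<and> V \<noteq> {0} \<and>
     (\<forall>W. is_YD_sub sc V act \<delta> W \<longrightarrow> W = {0} \<or> W = V)"

definition YD_isomorphic :: "('k \<Rightarrow> 'v \<Rightarrow> 'v::ab_group_add) \<Rightarrow> 'v set \<Rightarrow> ('k hel \<Rightarrow> 'v \<Rightarrow> 'v)
    \<Rightarrow> ('v \<Rightarrow> bidx \<Rightarrow>\<^sub>0 'v) \<Rightarrow> ('k \<Rightarrow> 'u \<Rightarrow> 'u::ab_group_add) \<Rightarrow> 'u set \<Rightarrow> ('k hel \<Rightarrow> 'u \<Rightarrow> 'u)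
    \<Rightarrow> ('u \<Rightarrow> bidx \<Rightarrow>\<^sub>0 'u) \<Rightarrow> bool" where
  "YD_isomorphic sc V act \<delta> sc' V' act' \<delta>' \<longleftrightarrow>
     (\<exists>f. bij_betw f V V' \<and>
       (\<forall>u\<in>V. \<forall>v\<in>V. f (u + v) = f u + f v) \<and> (\<forall>c. \<forall>v\<in>V. f (sc c v) = sc' c (f v)) \<and>
       (\<forall>h\<in>Hcar. \<forall>v\<in>V. f (act h v) = act' h (f v)) \<and>
       (\<forall>v\<in>V. \<delta>' (f v) = pmapV f (\<delta> v)))"

primrec cc :: "'k \<Rightarrow> int \<Rightarrow> int \<Rightarrow> nat \<Rightarrow> nat \<Rightarrow> 'k hel" where
  "cc \<beta> r i 0 = (\<lambda>l. if l = 0 then mono r i 0 else 0)"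
| "cc \<beta> r i (Suc k) = (\<lambda>l.
     if l = 0 then hmul (cc \<beta> r i k 0) Sy + psc \<beta> (hmul hy (hmul (cc \<beta> r i k 0) Sg))
     else if l < Suc k then hmul (cc \<beta> r i k l) Sy
          + psc (\<beta> * inverse \<gamma> ^ l) (hmul hy (hmul (cc \<beta> r i k l) Sg))
          + hmul (cc \<beta> r i k (l - 1)) Sg
     else if l = Suc k then hmul (cc \<beta> r i k k) Sg
     else 0)"

definition phi :: "int \<Rightarrow> int" where
  "phi t = (if t mod int n = 0 then int n else t mod int n)"

text \<open>the index m of the top basis vector of V(alpha,beta,x^r g^i)\<close>
definition mdim :: "'k \<Rightarrow> int \<Rightarrow> nat" where
  "mdim \<beta> i = (if \<exists>j::int. \<beta> = \<gamma> powi j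
     then nat (int n - phi (- i - (SOME j::int. \<beta> = \<gamma> powi j))) else n - 1)"

text \<open>The module V(alpha,beta,x^r g^i), realised on finitely supported functions nat => k,
  v_k being the k-th unit vector, with carrier the span of v_0, ..., v_m.\<close>
definition Vcar :: "'k \<Rightarrow> int \<Rightarrow> (nat \<Rightarrow>\<^sub>0 'k) set" where
  "Vcar \<beta> i = {f. Poly_Mapping.keys f \<subseteq> {..mdim \<beta> i}}"

definition Xop :: "'k \<Rightarrow> int \<Rightarrow> (nat \<Rightarrow>\<^sub>0 'k) \<Rightarrow> (nat \<Rightarrow>\<^sub>0 'k)" where
  "Xop \<alpha> r f = psc (\<alpha> powi r) f"

definition Gop :: "'k \<Rightarrow> (nat \<Rightarrow>\<^sub>0 'k) \<Rightarrow> (nat \<Rightarrow>\<^sub>0 'k)" where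
  "Gop \<beta> f = (\<Sum>k\<in>Poly_Mapping.keys f. Poly_Mapping.single k (\<beta> * inverse \<gamma> ^ k * Poly_Mapping.lookup f k))"

definition Yop :: "'k \<Rightarrow> nat \<Rightarrow> (nat \<Rightarrow>\<^sub>0 'k) \<Rightarrow> (nat \<Rightarrow>\<^sub>0 'k)" where
  "Yop \<beta> m f = (\<Sum>k\<in>Poly_Mapping.keys f. if k < m then Poly_Mapping.single (k + 1) (Poly_Mapping.lookup f k)
                              else Poly_Mapping.single 0 ((1 - \<beta> ^ n) * Poly_Mapping.lookup f k))"

definition Vact :: "'k \<Rightarrow> 'k \<Rightarrow> int \<Rightarrow> 'k hel \<Rightarrow> (nat \<Rightarrow>\<^sub>0 'k) \<Rightarrow> (nat \<Rightarrow>\<^sub>0 'k)" where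
  "Vact \<alpha> \<beta> i h f = (\<Sum>b\<in>Poly_Mapping.keys h. psc (Poly_Mapping.lookup h b)
      (case b of (r', i', j') \<Rightarrow> Xop \<alpha> r' ((Gop \<beta> ^^ i') ((Yop \<beta> (mdim \<beta> i) ^^ j') f))))"

definition Vdelta :: "'k \<Rightarrow> int \<Rightarrow> int \<Rightarrow> (nat \<Rightarrow>\<^sub>0 'k) \<Rightarrow> bidx \<Rightarrow>\<^sub>0 (nat \<Rightarrow>\<^sub>0 'k)" where
  "Vdelta \<beta> r i f = (\<Sum>k\<in>Poly_Mapping.keys f. \<Sum>l\<in>{..k}.
      tensV psc (cc \<beta> r i k l) (Poly_Mapping.single l (Poly_Mapping.lookup f k)))"

end

end

theory Submission imports Defs begin

text \<open>A nonzero comodule over \<open>H\<close> contains a vector with grouplike coaction \<open>x\<^sup>r g\<^sup>i\<close>, read off from a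
  coefficient of maximal \<open>y\<close>-degree. Such a vector generates a simple module \<open>V\<close>, so \<open>V\<close> is finitely generated
  over \<open>k[x,x\<^sup>-\<^sup>1]\<close>. The images and kernels of \<open>x - \<alpha>\<close> are Yetter-Drinfeld submodules; if \<open>x - 1\<close> is onto, Nakayama's
  argument shows that a nonzero polynomial in \<open>x\<close> annihilates \<open>V\<close>, and in either case \<open>x\<close> has an eigenvalue and
  acts as a scalar \<open>\<alpha>\<close>. Then \<open>g\<close> has an eigenvector \<open>v\<close> of eigenvalue \<open>\<beta>\<close> among the vectors of coaction
  \<open>x\<^sup>r g\<^sup>i\<close>, and the span of the \<open>y\<^sup>k v\<close>, whose coaction is given by the elements \<open>c(k,l)\<close>, is all of \<open>V\<close>.
  A closed formula for \<open>c(k,l)\<close> shows that the first \<open>k\<close> for which \<open>y\<^sup>k v\<close> has grouplike coaction again is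
  \<open>m + 1\<close> (if \<open>m + 1 < n\<close>), which determines the dimension and, for the isomorphism problem, makes the line of \<open>v\<^sub>0\<close>
  the only grouplike line of \<open>V(\<alpha>,\<beta>,x\<^sup>r g\<^sup>i)\<close>.\<close>

section \<open>Finitely supported functions\<close>

text \<open>A simple module is not assumed finite-dimensional and the field may be countable, so no
  cardinality form of Schur's lemma yields an eigenvalue of x; torsion has to be extracted from
  finite generation instead. What makes x accessible is that it is central and grouplike:
  conjugation by x is trivial, so x commutes with action and coaction, that is, it is an
  endomorphism of the Yetter-Drinfeld module. The element g is not central; it only preserves each
  space of vectors with a fixed grouplike coaction, and there g^n = x^w is the source of the
  relation \<alpha>^w = \<beta>^n. The point 1 in x - 1 is convenient because powers of x take the
  value 1 there, so clearing denominators does not disturb evaluation. The coaction is studied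
  through its coefficients at PBW basis elements, where the degree in y separates the summands:
  c(k,l) is concentrated in y-degree k - l as long as k < n.\<close>

lemma lookup_psc [simp]: "Poly_Mapping.lookup (psc c a) p = c * Poly_Mapping.lookup a p"
  by (simp add: psc_def Poly_Mapping.map.rep_eq when_def)

lemma psc_add_left: "psc (c + d) a = psc c a + psc d a"
  by (rule poly_mapping_eqI) (simp add: lookup_add distrib_right)

lemma psc_psc [simp]: "psc c (psc d a) = psc (c * d) a"
  by (rule poly_mapping_eqI) (simp add: mult.assoc)

lemma psc_one [simp]: "psc 1 a = (a :: 'a \<Rightarrow>\<^sub>0 'k::semiring_1)"
  by (rule poly_mapping_eqI) simp

lemma psc_zero [simp]: "psc 0 a = 0" "psc c 0 = 0"
  by (rule poly_mapping_eqI, simp)+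

lemma psc_single [simp]: "psc c (Poly_Mapping.single p d) = Poly_Mapping.single p (c * d)"
  by (rule poly_mapping_eqI) (simp add: lookup_single when_def)

lemma psc_sum: "psc c (sum f A) = (\<Sum>x\<in>A. psc c (f x))"
  by (rule poly_mapping_eqI) (simp add: lookup_sum sum_distrib_left)

lemma psc_minus: "psc (- c) a = - psc c (a :: 'a \<Rightarrow>\<^sub>0 'k::ring)" "psc c (- a) = - psc c (a :: 'a \<Rightarrow>\<^sub>0 'k::ring)"
  by (rule poly_mapping_eqI, simp)+

lemma keys_psc: "Poly_Mapping.keys (psc c a) \<subseteq> Poly_Mapping.keys a"
  by (auto simp: in_keys_iff)

lemma single_eq_0_iff [simp]: "Poly_Mapping.single p c = 0 \<longleftrightarrow> c = 0"
  by (metis lookup_single_eq lookup_zero single_zero)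

lemma sum_keys_superset:
  assumes "finite S" "Poly_Mapping.keys a \<subseteq> S" "\<And>p. F p 0 = 0"
  shows "(\<Sum>p\<in>Poly_Mapping.keys a. F p (Poly_Mapping.lookup a p)) = (\<Sum>p\<in>S. F p (Poly_Mapping.lookup a p))"
  by (rule sum.mono_neutral_left) (use assms in \<open>auto simp: in_keys_iff\<close>)

text \<open>Coefficients may cancel in a sum, so all three sums are compared over the union of the
  supports. Operations defined as sums over keys get their additivity from here.\<close>

lemma sum_keys_add:
  assumes "\<And>p. F p 0 = 0"
    "\<And>p. F p (Poly_Mapping.lookup a p + Poly_Mapping.lookup b p)
        = F p (Poly_Mapping.lookup a p) + F p (Poly_Mapping.lookup b p)"
  shows "(\<Sum>p\<in>Poly_Mapping.keys (a + b). F p (Poly_Mapping.lookup (a + b) p))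
       = (\<Sum>p\<in>Poly_Mapping.keys a. F p (Poly_Mapping.lookup a p))
       + (\<Sum>p\<in>Poly_Mapping.keys b. F p (Poly_Mapping.lookup b p))"
proof -
  let ?S = "Poly_Mapping.keys a \<union> Poly_Mapping.keys b"
  have "Poly_Mapping.keys (a + b) \<subseteq> ?S"
    by (rule keys_add)
  then show ?thesis
    using sum_keys_superset[of ?S "a + b" F] sum_keys_superset[of ?S a F] sum_keys_superset[of ?S b F] assms
    by (simp add: lookup_add sum.distrib)
qed

lemma sum_keys_single:
  assumes "F p 0 = 0"
  shows "(\<Sum>q\<in>Poly_Mapping.keys (Poly_Mapping.single p c). F q (Poly_Mapping.lookup (Poly_Mapping.single p c) q)) = F p c"
  using assms by (cases "c = 0") auto

lemma sum_keys_psc: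
  fixes a :: "'a \<Rightarrow>\<^sub>0 'k::field"
  assumes "\<And>p. F p 0 = 0"
  shows "(\<Sum>p\<in>Poly_Mapping.keys (psc c a). F p (Poly_Mapping.lookup (psc c a) p))
       = (\<Sum>p\<in>Poly_Mapping.keys a. F p (c * Poly_Mapping.lookup a p))"
  using sum_keys_superset[where F = F and a = "psc c a" and S = "Poly_Mapping.keys a"] assms keys_psc[of c a]
  by simp

lemma poly_mapping_sum_single:
  "(\<Sum>p\<in>Poly_Mapping.keys a. Poly_Mapping.single p (Poly_Mapping.lookup a p)) = a"
proof (rule poly_mapping_eqI)
  fix k
  show "Poly_Mapping.lookup (\<Sum>p\<in>Poly_Mapping.keys a. Poly_Mapping.single p (Poly_Mapping.lookup a p)) k = Poly_Mapping.lookup a k"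
    by (auto simp: lookup_sum lookup_single when_def sum.delta in_keys_iff)
qed

lemma lookup_tensV:
  assumes "\<And>u. sc 0 u = 0"
  shows "Poly_Mapping.lookup (tensV sc a u) p = sc (Poly_Mapping.lookup a p) u"
proof -
  have "Poly_Mapping.lookup (tensV sc a u) p
      = (\<Sum>b\<in>Poly_Mapping.keys a. if b = p then sc (Poly_Mapping.lookup a b) u else 0)"
    by (simp add: tensV_def lookup_sum lookup_single when_def)
  also have "\<dots> = sc (Poly_Mapping.lookup a p) u"
    using assms by (auto simp: in_keys_iff)
  finally show ?thesis .
qed

lemma lookup_pmapV:
  assumes "f 0 = 0"
  shows "Poly_Mapping.lookup (pmapV f t) p = f (Poly_Mapping.lookup t p)"
proof -
  have "Poly_Mapping.lookup (pmapV f t) p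
      = (\<Sum>b\<in>Poly_Mapping.keys t. if b = p then f (Poly_Mapping.lookup t b) else 0)"
    by (simp add: pmapV_def lookup_sum lookup_single when_def)
  also have "\<dots> = f (Poly_Mapping.lookup t p)"
    using assms by (auto simp: in_keys_iff)
  finally show ?thesis .
qed

section \<open>Multiplication of monomials\<close>

locale liu_algebra = Bnwg n w \<gamma> for n w :: nat and \<gamma> :: "'k::field" +
  assumes n_pos: "0 < n" and w_pos: "0 < w" and prim: "primitive_root n \<gamma>"
begin

lemma gamma_pow_n: "\<gamma> ^ n = 1"
  using prim by (simp add: primitive_root_def)

lemma gamma_nonzero [simp]: "\<gamma> \<noteq> 0"
  using gamma_pow_n n_pos by (cases "\<gamma> = 0") (auto simp: power_0_left)

lemma gamma_powi_n_mult: "\<gamma> powi (int n * t) = 1"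
  by (simp add: power_int_mult gamma_pow_n)

lemma gamma_powi_mod: "\<gamma> powi (t mod int n) = \<gamma> powi t"
proof -
  have "\<gamma> powi t = \<gamma> powi (int n * (t div int n) + t mod int n)"
    by simp
  also have "\<dots> = \<gamma> powi (t mod int n)"
    by (subst power_int_add) (simp_all add: gamma_powi_n_mult)
  finally show ?thesis by simp
qed

lemma gamma_powi_eq_1_iff: "\<gamma> powi t = 1 \<longleftrightarrow> int n dvd t"
proof
  assume *: "\<gamma> powi t = 1"
  define m where "m = nat (t mod int n)"
  have m: "int m = t mod int n" "m < n"
    using n_pos by (simp_all add: m_def nat_less_iff)
  have "\<gamma> ^ m = 1"
    using * gamma_powi_mod[of t] m by (metis power_int_of_nat)
  then have "m = 0"
    using prim m(2) by (auto simp: primitive_root_def)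
  then show "int n dvd t"
    using m(1) by (simp add: dvd_eq_mod_eq_0)
qed (auto simp: gamma_powi_n_mult)

lemma gamma_powi_eq_iff: "\<gamma> powi s = \<gamma> powi t \<longleftrightarrow> int n dvd s - t"
  by (simp add: gamma_powi_eq_1_iff[symmetric] power_int_diff)

section \<open>Bilinearity of the product and its values on monomials\<close>

lemma hmul_add_left: "hmul (a + b) c = hmul a c + hmul b c"
  unfolding hmul_def
  by (subst sum_keys_add[where F = "\<lambda>p s. \<Sum>q\<in>Poly_Mapping.keys c. psc (s * Poly_Mapping.lookup c q) (bmul p q)"])
    (simp_all add: distrib_right psc_add_left sum.distrib)

lemma hmul_add_right: "hmul a (b + c) = hmul a b + hmul a c"
  unfolding hmul_def
  by (subst sum_keys_add[where F = "\<lambda>q s. psc (Poly_Mapping.lookup a _ * s) (bmul _ q)"])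
    (simp_all add: distrib_left psc_add_left sum.distrib)

lemma hmul_psc_left: "hmul (psc t a) c = psc t (hmul a c)"
  unfolding hmul_def
  by (subst sum_keys_psc[where F = "\<lambda>p s. \<Sum>q\<in>Poly_Mapping.keys c. psc (s * Poly_Mapping.lookup c q) (bmul p q)"])
    (simp_all add: psc_sum mult.assoc)

lemma hmul_psc_right: "hmul a (psc t c) = psc t (hmul a c)"
  unfolding hmul_def
  by (subst sum_keys_psc[where F = "\<lambda>q s. psc (Poly_Mapping.lookup a _ * s) (bmul _ q)"])
    (simp_all add: psc_sum mult.assoc mult.left_commute)

lemma hmul_zero [simp]: "hmul 0 a = 0" "hmul a 0 = 0"
  by (simp_all add: hmul_def)

lemma hmul_minus_left: "hmul (- a) b = - hmul a b"
  using hmul_psc_left[of "-1" a b] by (simp add: psc_minus)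

lemma hmul_minus_right: "hmul a (- b) = - hmul a b"
  using hmul_psc_right[of a "-1" b] by (simp add: psc_minus)

lemma hmul_diff_left: "hmul (a - b) c = hmul a c - hmul b c"
  using hmul_add_left[of a "- b" c] by (simp add: hmul_minus_left)

lemma hmul_diff_right: "hmul a (b - c) = hmul a b - hmul a c"
  using hmul_add_right[of a b "- c"] by (simp add: hmul_minus_right)

lemma hmul_bas: "hmul (bas p) (bas q) = bmul p q"
  by (simp add: hmul_def bas_def)

lemma mono_low:
  "c < n \<Longrightarrow> mono a b c = bas (a + int w * (b div int n), nat (b mod int n), c)"
  by (simp add: mono_def bas_def)

lemma bas_mono: "valid (r, i, j) \<Longrightarrow> bas (r, i, j) = mono r (int i) j"
  by (simp add: mono_low valid_def)

lemma mono_shift_g: "mono a (b + int n * t) c = mono (a + int w * t) b c"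
  using n_pos by (simp add: mono_def algebra_simps)

text \<open>This is y^n = 1 - x^w in normal form. In the binomial expansion of (1 - x^w)^(c div n),
  raising the exponent by one is Pascal's rule.\<close>

lemma mono_shift_y: "mono a b (c + n) = mono a b c - mono (a + int w) b c"
proof -
  define f where "f t = a + int w * (b div int n) + int w * int t" for t
  define C where "C = c div n"
  let ?s = "\<lambda>t x. Poly_Mapping.single (f t, nat (b mod int n), c mod n) (x :: 'k)"
  have f: "f t + int w = f (Suc t)" for t
    by (simp add: f_def algebra_simps)
  have "mono a b (c + n) = (\<Sum>t\<le>Suc C. ?s t ((-1) ^ t * of_nat (Suc C choose t)))"
    using n_pos by (simp add: mono_def f_def C_def)
  also have "\<dots> = ?s 0 1 + (\<Sum>t\<le>C. ?s (Suc t) ((-1) ^ Suc t * of_nat (C choose Suc t)))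
      + (\<Sum>t\<le>C. ?s (Suc t) ((-1) ^ Suc t * of_nat (C choose t)))"
    by (simp add: sum.atMost_Suc_shift sum.distrib[symmetric] single_add[symmetric] algebra_simps del: sum.atMost_Suc)
  also have "?s 0 1 + (\<Sum>t\<le>C. ?s (Suc t) ((-1) ^ Suc t * of_nat (C choose Suc t)))
      = (\<Sum>t\<le>Suc C. ?s t ((-1) ^ t * of_nat (C choose t)))"
    by (simp add: sum.atMost_Suc_shift del: sum.atMost_Suc)
  also have "\<dots> = mono a b c"
    by (simp add: mono_def f_def C_def binomial_eq_0)
  also have "(\<Sum>t\<le>C. ?s (Suc t) ((-1) ^ Suc t * of_nat (C choose t))) = - mono (a + int w) b c"
    by (simp add: mono_def C_def f_def sum_negf[symmetric] single_uminus[symmetric] algebra_simps)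
  finally show ?thesis by simp
qed

text \<open>Moving y^c past g^b' costs \<gamma>^(c b'). The formula holds for basis elements by
  definition of \<open>bmul\<close>; larger exponents of y are lowered by n, first in the right
  factor and then in the left one. With arbitrary exponents allowed, products of monomials never
  have to be reduced by hand.\<close>

lemma hmul_mono:
  "hmul (mono a b c) (mono a' b' c') = psc (\<gamma> powi (int c * b')) (mono (a + a') (b + b') (c + c'))"
proof -
  have low: "hmul (mono a b c) (mono a' b' c') = psc (\<gamma> powi (int c * b')) (mono (a + a') (b + b') (c + c'))"
    if "c < n" "c' < n" for a b c a' b' c'
  proof -
    have "hmul (mono a b c) (mono a' b' c')
        = psc (\<gamma> ^ (c * nat (b' mod int n)))
            (mono (a + int w * (b div int n) + (a' + int w * (b' div int n)))
              (int (nat (b mod int n)) + int (nat (b' mod int n))) (c + c'))"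
      using that by (simp add: mono_low hmul_bas bmul_def)
    also have "\<gamma> ^ (c * nat (b' mod int n)) = (\<gamma> powi (b' mod int n)) powi int c"
      using n_pos by (metis mult.commute nat_0_le of_nat_0_less_iff pos_mod_sign power_int_of_nat power_mult)
    also have "\<dots> = \<gamma> powi (int c * b')"
      by (simp add: gamma_powi_mod power_int_mult mult.commute[of "int c"])
    also have "mono (a + int w * (b div int n) + (a' + int w * (b' div int n)))
              (int (nat (b mod int n)) + int (nat (b' mod int n))) (c + c')
        = mono (a + a') (b mod int n + b' mod int n + int n * (b div int n + b' div int n)) (c + c')"
      unfolding mono_shift_g using n_pos by (simp add: algebra_simps)
    also have "b mod int n + b' mod int n + int n * (b div int n + b' div int n) = b + b'"
      by (simp add: algebra_simps)
    finally show ?thesis .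
  qed
  \<comment> \<open>Lowering the left exponent of y by n does not change the commutation scalar,
    because \<gamma>^n = 1.\<close>
  have gam: "\<gamma> powi (int (d + n) * t) = \<gamma> powi (int d * t)" for d t
    by (simp add: gamma_powi_eq_iff algebra_simps)
  have right: "hmul (mono a b c) (mono a' b' c') = psc (\<gamma> powi (int c * b')) (mono (a + a') (b + b') (c + c'))"
    if "c < n" for a b c a' b' c'
  proof (induction c' arbitrary: a' rule: less_induct)
    case (less c')
    show ?case
    proof (cases "c' < n")
      case False
      define d where "d = c' - n"
      have d: "c' = d + n" "d < c'" using False n_pos by (auto simp: d_def)
      show ?thesis
        unfolding d(1) mono_shift_y hmul_diff_right less.IH[OF d(2)] add.assoc[symmetric]
        by (rule poly_mapping_eqI) (simp add: lookup_minus algebra_simps)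
    qed (simp add: low that)
  qed
  show ?thesis
  proof (induction c arbitrary: a rule: less_induct)
    case (less c)
    show ?case
    proof (cases "c < n")
      case False
      define d where "d = c - n"
      have d: "c = d + n" "d < c" using False n_pos by (auto simp: d_def)
      have "mono (a + a') (b + b') (d + n + c') = mono (a + a') (b + b') (d + c' + n)"
        by (simp only: add_ac)
      also have "\<dots> = mono (a + a') (b + b') (d + c') - mono (a + int w + a') (b + b') (d + c')"
        by (simp only: mono_shift_y) (simp only: add_ac)
      finally show ?thesis
        unfolding d(1) mono_shift_y hmul_diff_left less.IH[OF d(2)] gam
        by (intro poly_mapping_eqI) (simp add: lookup_minus right_diff_distrib)
    qed (simp add: right)
  qed
qed

lemma keys_mono:
  "p \<in> Poly_Mapping.keys (mono a b c) \<Longrightarrow> valid p \<and> snd (snd p) = c mod n"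
  unfolding mono_def using n_pos
  by (auto dest!: subsetD[OF keys_sum] simp: valid_def nat_less_iff split: if_splits)

lemma mono_in_Hcar [simp]: "mono a b c \<in> Hcar"
  using keys_mono by (auto simp: Hcar_def)

lemma bas_in_Hcar [simp]: "valid b \<Longrightarrow> bas b \<in> Hcar"
  by (simp add: Hcar_def bas_def)

lemma Hcar_add [simp]: "a \<in> Hcar \<Longrightarrow> b \<in> Hcar \<Longrightarrow> a + b \<in> Hcar"
  using keys_add[of a b] by (auto simp: Hcar_def)

lemma Hcar_psc [simp]: "a \<in> Hcar \<Longrightarrow> psc c a \<in> Hcar"
  using keys_psc[of c a] by (auto simp: Hcar_def)

lemma Hcar_zero [simp]: "0 \<in> Hcar"
  by (simp add: Hcar_def)

lemma Hcar_induct [consumes 1, case_names zero bas add]: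
  assumes "h \<in> Hcar" "P 0" "\<And>c b. valid b \<Longrightarrow> P (psc c (bas b))"
    "\<And>a b. a \<in> Hcar \<Longrightarrow> b \<in> Hcar \<Longrightarrow> P a \<Longrightarrow> P b \<Longrightarrow> P (a + b)"
  shows "P h"
proof -
  have "P (\<Sum>p\<in>S. Poly_Mapping.single p (Poly_Mapping.lookup h p)) \<and>
      (\<Sum>p\<in>S. Poly_Mapping.single p (Poly_Mapping.lookup h p)) \<in> Hcar"
    if "finite S" "\<forall>p\<in>S. valid p" for S
    using that
  proof induction
    case (insert p S)
    have "Poly_Mapping.single p (Poly_Mapping.lookup h p) = psc (Poly_Mapping.lookup h p) (bas p)"
      by (simp add: bas_def)
    with insert show ?case using assms by auto
  qed (simp add: assms)
  from this[of "Poly_Mapping.keys h"] show ?thesis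
    using assms(1) by (auto simp: poly_mapping_sum_single Hcar_def)
qed

lemma hmul_hx_commute: "h \<in> Hcar \<Longrightarrow> hmul hx h = hmul h hx"
proof (induction rule: Hcar_induct)
  case (bas c b)
  obtain r i j where "b = (r, i, j)" by (cases b)
  with bas show ?case
    by (simp add: bas_mono hmul_psc_left hmul_psc_right hx_def hmul_mono add.commute)
qed (simp_all add: hmul_add_left hmul_add_right)

lemma hmul_in_Hcar [simp]:
  assumes "a \<in> Hcar" "b \<in> Hcar" shows "hmul a b \<in> Hcar"
proof -
  have *: "hmul (bas p) b \<in> Hcar" if "valid p" for p
    using assms(2)
  proof (induction rule: Hcar_induct)
    case (bas c q)
    show ?case using bas that
      by (cases p; cases q) (simp add: bas_mono hmul_psc_right hmul_mono)
  qed (auto simp: hmul_add_right)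
  show ?thesis
    using assms(1) by (induction rule: Hcar_induct) (auto simp: hmul_add_left hmul_psc_left *)
qed

section \<open>The coaction coefficients\<close>

text \<open>The Gaussian binomial coefficient at q = \<gamma>^(-1), defined by the q-Pascal rule
  because the quotient of q-factorials breaks down at a root of unity.\<close>

primrec qbin :: "nat \<Rightarrow> nat \<Rightarrow> 'k" where
  "qbin 0 l = (if l = 0 then 1 else 0)"
| "qbin (Suc k) l = inverse \<gamma> ^ l * qbin k l + (if l = 0 then 0 else qbin k (l - 1))"

lemma qbin_eq_0: "k < l \<Longrightarrow> qbin k l = 0"
  by (induction k arbitrary: l) auto

lemma qbin_self [simp]: "qbin k k = 1"
  by (induction k) (simp_all add: qbin_eq_0)

lemma qbin_0_right [simp]: "qbin k 0 = 1"
  by (induction k) simp_all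

text \<open>The second q-Pascal rule, with q^(k-l) on the other summand, multiplied by
  \<gamma>^(k-l) to avoid negative powers.\<close>

lemma qbin_Suc_dual: "l \<le> k \<Longrightarrow> \<gamma> ^ (k - l) * qbin (Suc k) (Suc l) = \<gamma> ^ (k - l) * qbin k (Suc l) + qbin k l"
proof (induction k arbitrary: l)
  case (Suc k)
  show ?case
  proof (cases "l = Suc k")
    case False
    then obtain d where k: "k = l + d" using Suc.prems by (metis le_Suc_eq le_Suc_ex)
    show ?thesis
    proof (cases l)
      case 0
      have IH: "\<gamma> ^ k * qbin (Suc k) 1 = \<gamma> ^ k * qbin k 1 + 1"
        using Suc.IH[of 0] by simp
      have "\<gamma> ^ Suc k * qbin (Suc (Suc k)) 1 = \<gamma> ^ k * qbin (Suc k) 1 + \<gamma> ^ Suc k"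
        by (simp add: field_simps del: qbin.simps(2)) (simp add: field_simps)
      also have "\<dots> = \<gamma> ^ Suc k * qbin (Suc k) 1 + 1"
        unfolding IH by (simp add: field_simps)
      finally show ?thesis
        by (simp add: 0 del: qbin.simps)
    next
      case (Suc l')
      have 1: "\<gamma> ^ d * qbin (Suc k) (Suc l) = \<gamma> ^ d * qbin k (Suc l) + qbin k l"
        using Suc.IH[of l] k by simp
      have 2: "\<gamma> ^ Suc d * qbin (Suc k) l = \<gamma> ^ Suc d * qbin k l + qbin k l'"
        using Suc.IH[of l'] k Suc by simp
      have "\<gamma> ^ Suc d * qbin (Suc (Suc k)) (Suc l)
          = \<gamma> * inverse \<gamma> ^ Suc l * (\<gamma> ^ d * qbin (Suc k) (Suc l)) + \<gamma> ^ Suc d * qbin (Suc k) l"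
        by (simp add: algebra_simps)
      also have "\<dots> = \<gamma> ^ Suc d * (inverse \<gamma> ^ Suc l * qbin k (Suc l) + qbin k l)
          + (\<gamma> * inverse \<gamma> ^ Suc l * qbin k l + qbin k l')"
        unfolding 1 2 by (simp add: algebra_simps)
      also have "\<gamma> * inverse \<gamma> ^ Suc l * qbin k l = inverse \<gamma> ^ l * qbin k l"
        by simp
      finally show ?thesis
        using k Suc by simp
    qed
  qed (simp add: qbin_eq_0)
qed simp

lemma qbin_Suc_diag: "qbin (Suc k) k = (\<Sum>s\<le>k. inverse \<gamma> ^ s)"
  by (induction k) (simp_all add: algebra_simps)

text \<open>The value is the q-number (1 - q^(k+1)) / (1 - q) at q = \<gamma>^(-1), and \<gamma> is
  primitive of order n > k + 1.\<close>

lemma qbin_Suc_diag_nonzero: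
  assumes "Suc k < n" shows "qbin (Suc k) k \<noteq> 0"
proof
  assume *: "qbin (Suc k) k = 0"
  have "\<gamma> \<noteq> 1"
    using prim assms unfolding primitive_root_def by (auto dest!: spec[of _ 1])
  moreover have "(1 - inverse \<gamma>) * (\<Sum>s<Suc k. inverse \<gamma> ^ s) = 1 - inverse \<gamma> ^ Suc k"
    by (simp only: one_diff_power_eq)
  ultimately have "\<gamma> ^ Suc k = 1"
    using * by (simp only: qbin_Suc_diag lessThan_Suc_atMost) (simp add: field_simps)
  then show False
    using prim assms by (auto simp: primitive_root_def)
qed

text \<open>The product expands the recursion for the coefficients \<^term>\<open>cc\<close>:
  \<open>c(k,l)\<close> is a scalar multiple of \<open>x\<^sup>r y\<^sup>k\<^sup>-\<^sup>l g\<^sup>i\<^sup>-\<^sup>k\<close>, and it vanishes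
  for \<open>l < k < n\<close> exactly when some \<open>\<beta> - \<gamma>\<^sup>s\<^sup>-\<^sup>i\<close> with \<open>l \<le> s < k\<close> does.\<close>
definition cfac :: "'k \<Rightarrow> int \<Rightarrow> nat \<Rightarrow> nat \<Rightarrow> 'k" where
  "cfac \<beta> i k l = qbin k l * (\<Prod>s\<in>{l..<k}. \<beta> - \<gamma> powi (int s - i))"

lemma cfac_self [simp]: "cfac \<beta> i k k = 1"
  by (simp add: cfac_def)

text \<open>After the common product over l <= s < k is factored out, both sides are linear in
  \<beta>: the coefficients of \<beta> agree by the defining q-Pascal rule, the constant terms by
  the dual one.\<close>

lemma cfac_rec:
  assumes "l \<le> k"
  shows "cfac \<beta> i (Suc k) l = (\<beta> * inverse \<gamma> ^ l - \<gamma> powi (int k - i)) * cfac \<beta> i k l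
     + (if l = 0 then 0 else cfac \<beta> i k (l - 1))"
proof (cases l)
  case 0
  then show ?thesis by (simp add: cfac_def prod.atLeast0_lessThan_Suc)
next
  case (Suc l')
  define P where "P = (\<Prod>s\<in>{l..<k}. \<beta> - \<gamma> powi (int s - i))"
  have 1: "(\<Prod>s\<in>{l..<Suc k}. \<beta> - \<gamma> powi (int s - i)) = P * (\<beta> - \<gamma> powi (int k - i))"
    using assms by (simp add: P_def)
  have 2: "(\<Prod>s\<in>{l'..<k}. \<beta> - \<gamma> powi (int s - i)) = (\<beta> - \<gamma> powi (int l' - i)) * P"
    using assms Suc by (simp add: P_def prod.atLeast_Suc_lessThan)
  define d where "d = k - l'"
  have k: "k = l' + d" using assms Suc by (simp add: d_def)
  have dual: "\<gamma> ^ d * qbin (Suc k) l = \<gamma> ^ d * qbin k l + qbin k l'"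
    using qbin_Suc_dual[of l' k] assms Suc by (simp add: d_def)
  have g: "\<gamma> powi (int k - i) = \<gamma> powi (int l' - i) * \<gamma> ^ d"
    by (simp add: k power_int_diff power_int_add power_add)
  have "cfac \<beta> i (Suc k) l = P * (\<beta> * qbin (Suc k) l - \<gamma> powi (int l' - i) * (\<gamma> ^ d * qbin (Suc k) l))"
    unfolding cfac_def 1 g by (simp add: algebra_simps del: qbin.simps)
  also have "\<dots> = P * (\<beta> * (inverse \<gamma> ^ l * qbin k l + qbin k l') - \<gamma> powi (int l' - i) * (\<gamma> ^ d * qbin k l + qbin k l'))"
    unfolding dual by (simp add: Suc)
  also have "\<dots> = (\<beta> * inverse \<gamma> ^ l - \<gamma> powi (int k - i)) * cfac \<beta> i k l + cfac \<beta> i k l'"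
    unfolding cfac_def 2 g P_def[symmetric] by (simp add: algebra_simps)
  finally show ?thesis by (simp add: Suc)
qed

lemma Sg_mono: "hmul (mono a b c) Sg = psc (\<gamma> powi (- int c)) (mono a (b - 1) c)"
  by (simp add: Sg_def hmul_mono)

lemma Sy_eq: "Sy = psc (- inverse \<gamma>) (mono 0 (- 1) 1)"
  by (simp add: Sy_def hy_def Sg_mono psc_minus power_int_minus)

lemma hmul_mono_Sy: "hmul (mono a b c) Sy = psc (- (\<gamma> powi (- int c - 1))) (mono a (b - 1) (Suc c))"
  by (simp add: Sy_eq hmul_psc_right hmul_mono power_int_diff power_int_minus field_simps)

lemma hmul_hy_mono: "hmul hy (mono a b c) = psc (\<gamma> powi b) (mono a b (Suc c))"
  by (simp add: hy_def hmul_mono)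

text \<open>The power of \<gamma> is the price of moving y^(k-l) to the right of g^(i-k), as the
  normal form demands; the remaining scalar then obeys \<open>cfac_rec\<close>.\<close>

lemma cc_eq:
  "l \<le> k \<Longrightarrow> cc \<beta> r i k l
     = psc (cfac \<beta> i k l * \<gamma> powi ((int k - int l) * (i - int k))) (mono r (i - int k) (k - l))"
proof (induction k arbitrary: l)
  case 0
  then show ?case by (simp add: cfac_def)
next
  case (Suc k)
  \<comment> \<open>The two terms of the recursion that keep l: multiplication by S(y) contributes
    -\<gamma>^(k-i), the term with y on the left contributes \<beta> \<gamma>^(-l).\<close>
  have S1: "hmul (cc \<beta> r i k l) Sy + psc (\<beta> * inverse \<gamma> ^ l) (hmul hy (hmul (cc \<beta> r i k l) Sg))
      = psc ((\<beta> * inverse \<gamma> ^ l - \<gamma> powi (int k - i)) * cfac \<beta> i k l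
          * \<gamma> powi ((int (Suc k) - int l) * (i - int (Suc k)))) (mono r (i - int (Suc k)) (Suc k - l))"
    if l: "l \<le> k"
  proof -
    define e where "e = (int k - int l) * (i - int k)"
    have e1: "(int (Suc k) - int l) * (i - int (Suc k)) = e + - int (k - l) + (i - int k - 1)"
      using l by (simp add: e_def algebra_simps)
    have e2: "\<gamma> powi e * (\<gamma> powi (- int (k - l)) * \<gamma> powi (i - int k - 1))
        = \<gamma> powi ((int (Suc k) - int l) * (i - int (Suc k)))"
      unfolding e1 by (simp add: power_int_add[symmetric] algebra_simps)
    have e3: "\<gamma> powi e * \<gamma> powi (- int (k - l) - 1)
        = \<gamma> powi (int k - i) * \<gamma> powi ((int (Suc k) - int l) * (i - int (Suc k)))"
      unfolding e1 by (simp add: power_int_add[symmetric] algebra_simps)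
    have "hmul (cc \<beta> r i k l) Sy = psc (- (cfac \<beta> i k l * (\<gamma> powi e * \<gamma> powi (- int (k - l) - 1))))
        (mono r (i - int (Suc k)) (Suc k - l))"
      using l by (simp add: Suc.IH e_def hmul_psc_left hmul_mono_Sy Suc_diff_le algebra_simps)
    moreover have "psc (\<beta> * inverse \<gamma> ^ l) (hmul hy (hmul (cc \<beta> r i k l) Sg))
        = psc (\<beta> * inverse \<gamma> ^ l * cfac \<beta> i k l * (\<gamma> powi e * (\<gamma> powi (- int (k - l)) * \<gamma> powi (i - int k - 1))))
        (mono r (i - int (Suc k)) (Suc k - l))"
      using l by (simp add: Suc.IH e_def hmul_psc_left hmul_psc_right Sg_mono hmul_hy_mono
          Suc_diff_le mult.assoc diff_diff_eq add.commute)
    ultimately show ?thesis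
      unfolding e2 e3 by (simp add: psc_add_left[symmetric] algebra_simps)
  qed
  have S2: "hmul (cc \<beta> r i k l') Sg = psc (cfac \<beta> i k l'
          * \<gamma> powi ((int k - int l') * (i - int (Suc k)))) (mono r (i - int (Suc k)) (k - l'))"
    if l': "l' \<le> k" for l'
  proof -
    have "\<gamma> powi ((int k - int l') * (i - int k)) * \<gamma> powi (- int (k - l'))
        = \<gamma> powi ((int k - int l') * (i - int (Suc k)))"
      using l' by (simp add: power_int_add[symmetric] algebra_simps)
    then show ?thesis
      using l' by (simp add: Suc.IH hmul_psc_left Sg_mono diff_diff_eq add.commute mult.assoc)
  qed
  consider "l = 0" | l' where "l = Suc l'" "l \<le> k" | "l = Suc k"
    using Suc.prems by (metis le_Suc_eq not0_implies_Suc)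
  then show ?case
  proof cases
    case 1
    then show ?thesis using S1 by (simp add: cfac_rec)
  next
    case 2
    then show ?thesis
      using S1 S2[of l'] by (simp add: cfac_rec psc_add_left distrib_right)
  next
    case 3
    then show ?thesis using S2[of k] by simp
  qed
qed

lemma cc_self: "cc \<beta> r i k k = mono r (i - int k) 0"
  by (simp add: cc_eq)

text \<open>The factor s = k of the product is zero.\<close>

lemma cc_eq_0:
  assumes "\<beta> = \<gamma> powi (int k - i)" "l \<le> k"
  shows "cc \<beta> r i (Suc k) l = 0"
proof -
  have "cfac \<beta> i (Suc k) l = 0"
    using assms by (auto simp: cfac_def)
  then show ?thesis
    using assms(2) by (simp add: cc_eq del: cc.simps)
qed

lemma keys_cc: "l \<le> k \<Longrightarrow> p \<in> Poly_Mapping.keys (cc \<beta> r i k l) \<Longrightarrow> valid p \<and> snd (snd p) = (k - l) mod n"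
  using keys_psc keys_mono by (fastforce simp: cc_eq)

text \<open>Just below the diagonal the product has the single factor s = k, and the q-number in
  front of it is nonzero.\<close>

lemma cc_subdiag_nonzero:
  assumes "Suc k < n" "\<beta> \<noteq> \<gamma> powi (int k - i)"
  shows "cc \<beta> r i (Suc k) k \<noteq> 0"
proof
  assume "cc \<beta> r i (Suc k) k = 0"
  then have "psc (cfac \<beta> i (Suc k) k * \<gamma> powi (i - int (Suc k))) (mono r (i - int (Suc k)) 1) = 0"
    by (simp add: cc_eq del: cc.simps)
  then have "cfac \<beta> i (Suc k) k = 0"
    using assms by (simp add: mono_low bas_def single_eq_0_iff)
  then show False
    using assms qbin_Suc_diag_nonzero[of k] by (simp add: cfac_def)
qed

section \<open>The top index m\<close>

lemma mdim_less: "mdim \<beta> i < n"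
proof -
  have pos: "phi t > 0" for t
    using n_pos pos_mod_sign[of "int n" t] by (auto simp: phi_def simp del: pos_mod_sign)
  then have "nat (int n - phi t) < n" for t
    using n_pos pos[of t] by linarith
  then show ?thesis
    using n_pos by (auto simp: mdim_def)
qed

text \<open>The exponent j is determined only modulo n, but \<open>phi\<close> is n-periodic, and
  modulo n its formula reads m = i + j. This disposes of the choice operator.\<close>

lemma mdim_cases:
  obtains "\<not> (\<exists>j. \<beta> = \<gamma> powi j)" "mdim \<beta> i = n - 1"
  | "\<beta> = \<gamma> powi (int (mdim \<beta> i) - i)"
proof (cases "\<exists>j::int. \<beta> = \<gamma> powi j")
  case True
  define j :: int where "j = (SOME j. \<beta> = \<gamma> powi j)"
  have j: "\<beta> = \<gamma> powi j"
    unfolding j_def using True by (rule someI_ex)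
  have m: "mdim \<beta> i = nat (int n - phi (- i - j))"
    using True by (simp add: mdim_def j_def)
  have "phi (- i - j) \<le> int n"
    using n_pos by (auto simp: phi_def less_imp_le)
  then have "int (mdim \<beta> i) - i - j = int n + (- i - j - phi (- i - j))"
    by (simp add: m)
  also have "int n dvd \<dots>"
    by (auto simp: phi_def dvd_eq_mod_eq_0 minus_mod_eq_mult_div)
  finally have "\<beta> = \<gamma> powi (int (mdim \<beta> i) - i)"
    unfolding j gamma_powi_eq_iff by (metis dvd_minus_iff minus_diff_eq)
  then show ?thesis using that by blast
next
  case False
  then show ?thesis using that by (simp add: mdim_def)
qed

text \<open>Two exponents k giving the same \<beta> differ by a multiple of n, and both k and m lie
  below n. So m is the first index at which a factor of \<open>cfac\<close> can vanish.\<close>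

lemma beta_neq_of_less_mdim:
  assumes "k < mdim \<beta> i" shows "\<beta> \<noteq> \<gamma> powi (int k - i)"
proof
  assume b: "\<beta> = \<gamma> powi (int k - i)"
  show False
  proof (cases rule: mdim_cases[of \<beta> i])
    case 2
    then have "int n dvd int k - int (mdim \<beta> i)"
      using b gamma_powi_eq_iff by (metis add_diff_cancel_right diff_add_cancel)
    then have "int n dvd int (mdim \<beta> i) - int k"
      by (simp add: dvd_diff_commute)
    with assms mdim_less[of \<beta> i] show False
      using zdvd_imp_le[of "int n" "int (mdim \<beta> i) - int k"] by simp
  qed (use b in blast)
qed

section \<open>The coproduct on basis elements\<close>

lemma tens_bas: "tens (bas p) (bas q) = Poly_Mapping.single (p, q) 1"
  by (simp add: tens_def bas_def)

lemma keys_tens: "P \<in> Poly_Mapping.keys (tens a b) \<Longrightarrow> fst P \<in> Poly_Mapping.keys a \<and> snd P \<in> Poly_Mapping.keys b"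
  unfolding tens_def by (auto dest!: subsetD[OF keys_sum] split: if_splits)

lemma tmul_add_left: "tmul (A + B) C = tmul A C + tmul B C"
  unfolding tmul_def
  by (subst sum_keys_add[where F = "\<lambda>P s. \<Sum>Q\<in>Poly_Mapping.keys C.
        psc (s * Poly_Mapping.lookup C Q) (tens (bmul (fst P) (fst Q)) (bmul (snd P) (snd Q)))"])
    (simp_all add: distrib_right psc_add_left sum.distrib)

lemma tmul_add_right: "tmul A (B + C) = tmul A B + tmul A C"
  unfolding tmul_def
  by (subst sum_keys_add[where F = "\<lambda>Q s. psc (Poly_Mapping.lookup A _ * s)
        (tens (bmul (fst _) (fst Q)) (bmul (snd _) (snd Q)))"])
    (simp_all add: distrib_left psc_add_left sum.distrib)

lemma tmul_single:
  "tmul (Poly_Mapping.single (p, q) 1) (Poly_Mapping.single (p', q') 1) = tens (bmul p p') (bmul q q')"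
  by (simp add: tmul_def)

lemma tmul_tens_mono:
  assumes "c < n" "c' < n" "f < n" "f' < n"
  shows "tmul (tens (mono a b c) (mono a' b' c')) (tens (mono d e f) (mono d' e' f'))
    = tens (hmul (mono a b c) (mono d e f)) (hmul (mono a' b' c') (mono d' e' f'))"
  using assms by (simp add: mono_low tens_bas tmul_single hmul_bas)

lemma keys_bmul: "p \<in> Poly_Mapping.keys (bmul q q') \<Longrightarrow> valid p \<and> snd (snd p) = (snd (snd q) + snd (snd q')) mod n"
  unfolding bmul_def by (cases q; cases q') (auto dest!: subsetD[OF keys_psc] keys_mono)

lemma keys_tmul:
  assumes "P \<in> Poly_Mapping.keys (tmul A B)"
  obtains Q Q' where "Q \<in> Poly_Mapping.keys A" "Q' \<in> Poly_Mapping.keys B"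
    "fst P \<in> Poly_Mapping.keys (bmul (fst Q) (fst Q'))" "snd P \<in> Poly_Mapping.keys (bmul (snd Q) (snd Q'))"
proof -
  obtain Q Q' where "Q \<in> Poly_Mapping.keys A" "Q' \<in> Poly_Mapping.keys B"
    "P \<in> Poly_Mapping.keys (psc (Poly_Mapping.lookup A Q * Poly_Mapping.lookup B Q') (tens (bmul (fst Q) (fst Q')) (bmul (snd Q) (snd Q'))))"
    using assms unfolding tmul_def by (blast dest: subsetD[OF keys_sum])
  with that show ?thesis
    by (blast dest: subsetD[OF keys_psc] keys_tens)
qed

lemma tpow_grouplike:
  "tpow (tens (mono a b 0) (mono a b 0)) k = tens (mono (int k * a) (int k * b) 0) (mono (int k * a) (int k * b) 0)"
  using n_pos by (induction k) (simp_all add: hone_def tmul_tens_mono hmul_mono algebra_simps)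

text \<open>Only the left tensor factor is measured: coassociativity will be read off at a left
  factor of maximal y-degree.\<close>

definition deg_less :: "nat \<Rightarrow> ((bidx \<times> bidx) \<Rightarrow>\<^sub>0 'k) \<Rightarrow> bool" where
  "deg_less d A \<longleftrightarrow> (\<forall>P\<in>Poly_Mapping.keys A. snd (snd (fst P)) < d)"

lemma deg_less_add: "deg_less d A \<Longrightarrow> deg_less d B \<Longrightarrow> deg_less d (A + B)"
  using keys_add[of A B] by (auto simp: deg_less_def)

text \<open>Degrees in y add, and reduction modulo n only lowers them.\<close>

lemma deg_less_tmul:
  assumes "deg_less (Suc e) A" "deg_less d B" shows "deg_less (e + d) (tmul A B)"
  unfolding deg_less_def
proof
  fix P assume "P \<in> Poly_Mapping.keys (tmul A B)"
  then obtain Q Q' where Q: "Q \<in> Poly_Mapping.keys A" "Q' \<in> Poly_Mapping.keys B"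
    "fst P \<in> Poly_Mapping.keys (bmul (fst Q) (fst Q'))"
    by (rule keys_tmul)
  have "snd (snd (fst P)) \<le> snd (snd (fst Q)) + snd (snd (fst Q'))"
    using keys_bmul[OF Q(3)] by simp
  also have "\<dots> < e + d"
    using Q(1,2) assms by (fastforce simp: deg_less_def)
  finally show "snd (snd (fst P)) < e + d" .
qed

lemma deg_less_tens_mono: "c < d \<Longrightarrow> deg_less d (tens (mono a b c) h)"
  by (auto simp: deg_less_def dest!: keys_tens keys_mono intro: le_less_trans[OF mod_less_eq_dividend])

text \<open>Each factor 1 \<otimes> y leaves the degree of the left side unchanged, so only (y
  \<otimes> g)^j reaches degree j. The q-binomial expansion of the rest is never computed.\<close>

lemma tpow_y_leading:
  "j < n \<Longrightarrow> \<exists>L. tpow (tens hy hg + tens hone hy) j = tens (mono 0 0 j) (mono 0 (int j) 0) + L \<and> deg_less j L"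
proof (induction j)
  case 0
  then show ?case by (intro exI[of _ 0]) (simp add: hone_def deg_less_def)
next
  case (Suc j)
  then obtain L where L: "tpow (tens hy hg + tens hone hy) j = tens (mono 0 0 j) (mono 0 (int j) 0) + L" "deg_less j L"
    by auto
  define T where "T = tens hy hg + tens hone hy"
  have "tmul (tens hy hg) (tens (mono 0 0 j) (mono 0 (int j) 0)) = tens (mono 0 0 (Suc j)) (mono 0 (int (Suc j)) 0)"
    unfolding hy_def hg_def using Suc.prems by (subst tmul_tens_mono) (simp_all add: hmul_mono)
  then have eq: "tmul T (tens (mono 0 0 j) (mono 0 (int j) 0) + L)
      = tens (mono 0 0 (Suc j)) (mono 0 (int (Suc j)) 0)
      + (tmul (tens hone hy) (tens (mono 0 0 j) (mono 0 (int j) 0)) + tmul T L)"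
    by (simp add: T_def tmul_add_left tmul_add_right add.assoc)
  have T: "deg_less (Suc 1) T"
    unfolding T_def hy_def hone_def by (intro deg_less_add deg_less_tens_mono) simp_all
  have "deg_less (0 + Suc j) (tmul (tens hone hy) (tens (mono 0 0 j) (mono 0 (int j) 0)))"
    unfolding hone_def by (intro deg_less_tmul deg_less_tens_mono) simp_all
  moreover have "deg_less (1 + j) (tmul T L)"
    by (rule deg_less_tmul[OF T L(2)])
  ultimately have "deg_less (Suc j) (tmul (tens hone hy) (tens (mono 0 0 j) (mono 0 (int j) 0)) + tmul T L)"
    by (simp add: deg_less_add)
  then show ?case
    using eq L(1) by (auto simp: T_def)
qed

lemma tpow_x:
  "(if r \<ge> 0 then tpow (tens hx hx) (nat r) else tpow (tens hxinv hxinv) (nat (- r))) = tens (mono r 0 0) (mono r 0 0)"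
  unfolding hx_def hxinv_def tpow_grouplike by simp

lemma Dbasis_leading:
  assumes "j < n"
  obtains L where "Dbasis (r, i, j) = tens (mono r (int i) j) (mono r (int i + int j) 0) + L" "deg_less j L"
proof -
  obtain L where L: "tpow (tens hy hg + tens hone hy) j = tens (mono 0 0 j) (mono 0 (int j) 0) + L" "deg_less j L"
    using tpow_y_leading[OF assms] by blast
  let ?x = "tens (mono r 0 0) (mono r 0 0)" and ?g = "tens (mono 0 (int i) 0) (mono 0 (int i) 0)"
  have g: "tpow (tens hg hg) i = ?g"
    unfolding hg_def tpow_grouplike by simp
  have "Dbasis (r, i, j) = tmul ?x (tmul ?g (tens (mono 0 0 j) (mono 0 (int j) 0))) + tmul ?x (tmul ?g L)"
    by (simp add: Dbasis_def tpow_x g L tmul_add_right)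
  also have "tmul ?x (tmul ?g (tens (mono 0 0 j) (mono 0 (int j) 0)))
     = tens (mono r (int i) j) (mono r (int i + int j) 0)"
    using assms n_pos by (simp add: tmul_tens_mono hmul_mono)
  finally have "Dbasis (r, i, j) = tens (mono r (int i) j) (mono r (int i + int j) 0) + tmul ?x (tmul ?g L)" .
  moreover have "deg_less (0 + (0 + j)) (tmul ?x (tmul ?g L))"
    by (intro deg_less_tmul L deg_less_tens_mono) simp_all
  ultimately show ?thesis using that by simp
qed

text \<open>Apart from the leading term, whose left factor is b' itself, all left factors have
  smaller y-degree than b', hence than b.\<close>

lemma lookup_Dbasis_top:
  assumes "valid b'" "valid b" "snd (snd b') \<le> snd (snd b)"
  shows "Poly_Mapping.lookup (Dbasis b') (b, q) =
    (if b' = b then Poly_Mapping.lookup (mono (fst b) (int (fst (snd b)) + int (snd (snd b))) 0) q else 0)"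
proof -
  obtain r i j where b': "b' = (r, i, j)" by (cases b')
  have j: "i < n" "j < n" using assms(1) by (auto simp: b' valid_def)
  obtain L where L: "Dbasis (r, i, j) = tens (mono r (int i) j) (mono r (int i + int j) 0) + L" "deg_less j L"
    using Dbasis_leading j(2) by blast
  have "Poly_Mapping.lookup L (b, q) = 0"
    using L(2) assms(3) by (force simp: deg_less_def b' in_keys_iff)
  moreover have "tens (mono r (int i) j) (mono r (int i + int j) 0)
     = Poly_Mapping.single (b', r + int w * ((int i + int j) div int n), nat ((int i + int j) mod int n), 0) 1"
    using j n_pos by (simp add: mono_low tens_bas b')
  ultimately show ?thesis
    using n_pos unfolding b' L(1) lookup_add
    by (auto simp: lookup_single when_def mono_low bas_def)
qed

lemma Dbasis_valid: "P \<in> Poly_Mapping.keys (Dbasis b) \<Longrightarrow> valid (fst P) \<and> valid (snd P)"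
  by (cases b) (auto simp: Dbasis_def elim!: keys_tmul dest: keys_bmul)

lemma hDelta_bas: "hDelta (bas b) = Dbasis b"
  by (simp add: hDelta_def bas_def)

lemma hDelta2_valid:
  assumes "T \<in> Poly_Mapping.keys (hDelta2 h)"
  shows "valid (fst (snd T))"
proof -
  obtain P Q where "Q \<in> Poly_Mapping.keys (Dbasis (fst P))" "T = (fst Q, snd Q, snd P)"
    using assms unfolding hDelta2_def by (auto dest!: subsetD[OF keys_sum] split: if_splits)
  then show ?thesis using Dbasis_valid by auto
qed

lemma Dbasis_grouplike:
  assumes "i < n" shows "Dbasis (r, i, 0) = Poly_Mapping.single ((r, i, 0), (r, i, 0)) 1"
proof -
  obtain L where "Dbasis (r, i, 0) = tens (mono r (int i) 0) (mono r (int i) 0) + L" "deg_less 0 L"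
    using Dbasis_leading[of 0 r i] n_pos by auto
  moreover from this(2) have "L = 0"
    by (intro poly_mapping_eqI) (auto simp: deg_less_def in_keys_iff)
  ultimately show ?thesis
    using assms n_pos by (simp add: mono_low tens_bas)
qed

lemma hDelta2_grouplike:
  "i < n \<Longrightarrow> hDelta2 (bas (r, i, 0)) = Poly_Mapping.single ((r, i, 0), (r, i, 0), (r, i, 0)) 1"
  by (simp add: hDelta2_def hDelta_bas Dbasis_grouplike)

lemma hpow_grouplike: "hpow (mono a b 0) k = mono (int k * a) (int k * b) 0"
  by (induction k) (simp_all add: hone_def hmul_mono algebra_simps)

lemma Sbasis_grouplike: "Sbasis (r, i, 0) = mono (- r) (- int i) 0"
  by (simp add: Sbasis_def Sg_def hx_def hxinv_def hpow_grouplike hmul_mono hone_def)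

lemma Sbasis_y: "Sbasis (0, 0, 1) = Sy"
  by (simp add: Sbasis_def hone_def hmul_mono Sy_eq hmul_psc_left)

text \<open>For n = 1 the index (0,0,1) is not valid, since y is then 1 - x^w; hence the case 1 <
  n.\<close>

lemma Dbasis_y:
  assumes "1 < n"
  shows "Dbasis (0, 0, 1) = Poly_Mapping.single ((0, 0, 1), (0, 1, 0)) 1 + Poly_Mapping.single ((0, 0, 0), (0, 0, 1)) 1"
  using assms
  by (simp add: Dbasis_def hy_def hone_def hg_def tmul_add_left tmul_add_right tmul_tens_mono hmul_mono)
    (simp add: mono_low tens_bas)

lemma hDelta2_y:
  assumes "1 < n"
  shows "hDelta2 (bas (0, 0, 1)) = Poly_Mapping.single ((0, 0, 1), (0, 1, 0), (0, 1, 0)) 1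
     + Poly_Mapping.single ((0, 0, 0), (0, 0, 1), (0, 1, 0)) 1 + Poly_Mapping.single ((0, 0, 0), (0, 0, 0), (0, 0, 1)) 1"
proof -
  let ?F = "\<lambda>P s. \<Sum>Q\<in>Poly_Mapping.keys (Dbasis (fst P)).
      Poly_Mapping.single (fst Q, snd Q, snd P) (s * Poly_Mapping.lookup (Dbasis (fst P)) Q)"
  have F: "?F P (x + y) = ?F P x + ?F P y" "?F P 0 = 0" for P and x y :: 'k
    by (simp_all add: distrib_right single_add sum.distrib)
  have "hDelta2 (bas (0, 0, 1)) = ?F ((0, 0, 1), (0, 1, 0)) 1 + ?F ((0, 0, 0), (0, 0, 1)) 1"
    unfolding hDelta2_def hDelta_bas Dbasis_y[OF assms]
    by (subst sum_keys_add[where F = ?F]) (simp_all add: F sum_keys_single[where F = ?F] del: fst_conv snd_conv)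
  also have "?F ((0, 0, 0), (0, 0, 1)) 1 = Poly_Mapping.single ((0, 0, 0), (0, 0, 0), (0, 0, 1)) 1"
    using assms by (simp add: Dbasis_grouplike)
  also have "?F ((0, 0, 1), (0, 1, 0)) 1 = Poly_Mapping.single ((0, 0, 1), (0, 1, 0), (0, 1, 0)) 1
     + Poly_Mapping.single ((0, 0, 0), (0, 0, 1), (0, 1, 0)) 1"
    unfolding fst_conv Dbasis_y[OF assms]
    by (subst sum_keys_add[where F = "\<lambda>Q s. Poly_Mapping.single (fst Q, snd Q, _) (1 * s)"]) (simp_all add: single_add)
  finally show ?thesis by simp
qed

end

section \<open>Polynomials in a linear operator\<close>

locale operator_on = vs: vector_space sc for sc :: "'k::field \<Rightarrow> 'v::ab_group_add \<Rightarrow> 'v" +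
  fixes V :: "'v set" and X :: "'v \<Rightarrow> 'v"
  assumes subspace_V: "vs.subspace V"
    and X_in: "v \<in> V \<Longrightarrow> X v \<in> V"
    and X_add: "u \<in> V \<Longrightarrow> v \<in> V \<Longrightarrow> X (u + v) = X u + X v"
    and X_scale: "v \<in> V \<Longrightarrow> X (sc c v) = sc c (X v)"
begin

lemmas V_zero = vs.subspace_0[OF subspace_V]
  and V_add = vs.subspace_add[OF subspace_V]
  and V_scale = vs.subspace_scale[OF subspace_V]
  and V_diff = vs.subspace_diff[OF subspace_V]
  and V_sum = vs.subspace_sum[OF subspace_V]

lemma X_zero: "X 0 = 0"
  using X_scale[of 0 0] V_zero by simp

text \<open>Evaluation p(X)v in Horner form, which makes V a module over the polynomial
  ring.\<close>

definition papp :: "'k poly \<Rightarrow> 'v \<Rightarrow> 'v" where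
  "papp p v = fold_coeffs (\<lambda>a u. sc a v + X u) p 0"

lemma papp_0 [simp]: "papp 0 v = 0"
  by (simp add: papp_def)

lemma papp_pCons: "papp (pCons a p) v = sc a v + X (papp p v)"
  by (cases "p = 0 \<and> a = 0") (auto simp: papp_def X_zero)

lemma papp_in: "v \<in> V \<Longrightarrow> papp p v \<in> V"
  by (induction p) (simp_all add: papp_pCons V_zero V_add V_scale X_in)

lemma papp_add: "v \<in> V \<Longrightarrow> papp (p + q) v = papp p v + papp q v"
  by (induction p q rule: poly_induct2)
    (simp_all add: papp_pCons X_add papp_in vs.scale_left_distrib algebra_simps)

lemma papp_smult: "v \<in> V \<Longrightarrow> papp (smult c p) v = sc c (papp p v)"
  by (induction p) (simp_all add: papp_pCons X_scale papp_in vs.scale_right_distrib)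

lemma papp_diff: "v \<in> V \<Longrightarrow> papp (p - q) v = papp p v - papp q v"
  using papp_add[of v p "- q"] papp_smult[of v "-1" q] by simp

lemma papp_mult: "v \<in> V \<Longrightarrow> papp (p * q) v = papp p (papp q v)"
  by (induction p) (simp_all add: papp_pCons papp_add papp_smult)

lemma papp_vadd: "u \<in> V \<Longrightarrow> v \<in> V \<Longrightarrow> papp p (u + v) = papp p u + papp p v"
  by (induction p) (simp_all add: papp_pCons X_add papp_in vs.scale_right_distrib algebra_simps)

lemma papp_vzero: "papp p 0 = 0"
  by (induction p) (simp_all add: papp_pCons X_zero)

lemma papp_vsum: "(\<And>i. i \<in> I \<Longrightarrow> f i \<in> V) \<Longrightarrow> papp p (sum f I) = (\<Sum>i\<in>I. papp p (f i))"
  by (induction I rule: infinite_finite_induct) (simp_all add: papp_vzero papp_vadd V_sum)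

lemma papp_linear: "v \<in> V \<Longrightarrow> papp [:a, 1:] v = X v + sc a v"
  by (simp add: papp_pCons X_zero add.commute)

lemma papp_X_power: "papp ([:0, 1:] ^ N) v = (X ^^ N) v"
  by (induction N) (simp_all add: papp_pCons one_pCons X_zero)

text \<open>Split off a root, p = (X - \<alpha>) q. Either q already kills v and has smaller degree,
  or q(X)v is an eigenvector.\<close>

lemma exists_eigenvector:
  assumes "alg_closed TYPE('k)" "p \<noteq> 0" "v \<in> V" "v \<noteq> 0" "papp p v = 0"
  shows "\<exists>\<alpha> u. u \<in> V \<and> u \<noteq> 0 \<and> X u = sc \<alpha> u"
  using assms(2,5)
proof (induction "degree p" arbitrary: p rule: less_induct)
  case less
  show ?case
  proof (cases "degree p = 0")
    case True
    then obtain c where "p = [:c:]" by (rule degree_eq_zeroE)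
    then show ?thesis using less.prems assms(4) by (simp add: papp_pCons X_zero)
  next
    case False
    then obtain \<alpha> where "poly p \<alpha> = 0"
      using assms(1) by (auto simp: alg_closed_def)
    then obtain q where p: "p = [:- \<alpha>, 1:] * q"
      by (auto simp: poly_eq_0_iff_dvd)
    have q: "q \<noteq> 0" using p less.prems(1) by auto
    then have "degree p = Suc (degree q)"
      unfolding p by (subst degree_mult_eq) simp_all
    show ?thesis
    proof (cases "papp q v = 0")
      case True
      then show ?thesis
        using less.hyps[of q] q \<open>degree p = Suc (degree q)\<close> by simp
    next
      case False
      have "papp p v = X (papp q v) - sc \<alpha> (papp q v)"
        unfolding p papp_mult[OF assms(3)] by (simp add: papp_linear papp_in assms(3))
      then show ?thesis
        using False less.prems(2) papp_in[OF assms(3)] by auto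
    qed
  qed
qed

text \<open>The k[X]-submodule generated by the e i. Coefficients are ordinary polynomials, so
  denominators are cleared by a separate power of X.\<close>

definition gen :: "'i set \<Rightarrow> ('i \<Rightarrow> 'v) \<Rightarrow> 'v set" where
  "gen I e = {v. \<exists>q. v = (\<Sum>i\<in>I. papp (q i) (e i))}"

lemma gen_add:
  assumes "\<And>i. i \<in> I \<Longrightarrow> e i \<in> V" "u \<in> gen I e" "v \<in> gen I e"
  shows "u + v \<in> gen I e"
proof -
  obtain q q' where "u = (\<Sum>i\<in>I. papp (q i) (e i))" "v = (\<Sum>i\<in>I. papp (q' i) (e i))"
    using assms by (auto simp: gen_def)
  then have "u + v = (\<Sum>i\<in>I. papp (q i + q' i) (e i))"
    using assms(1) by (simp add: papp_add sum.distrib)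
  then show ?thesis unfolding gen_def by (auto intro: exI[of _ "\<lambda>i. q i + q' i"])
qed

lemma gen_papp:
  assumes "\<And>i. i \<in> I \<Longrightarrow> e i \<in> V" "u \<in> gen I e"
  shows "papp p u \<in> gen I e"
proof -
  obtain q where "u = (\<Sum>i\<in>I. papp (q i) (e i))"
    using assms by (auto simp: gen_def)
  then have "papp p u = (\<Sum>i\<in>I. papp (p * q i) (e i))"
    using assms(1) by (simp add: papp_mult papp_vsum papp_in)
  then show ?thesis unfolding gen_def by (auto intro: exI[of _ "\<lambda>i. p * q i"])
qed

lemma gen_base:
  assumes "finite I" "i \<in> I"
  shows "papp p (e i) \<in> gen I e"
proof -
  have "(\<Sum>j\<in>I. papp (if j = i then p else 0) (e j)) = (\<Sum>j\<in>I. if j = i then papp p (e j) else 0)"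
    by (rule sum.cong) auto
  then have "papp p (e i) = (\<Sum>j\<in>I. papp (if j = i then p else 0) (e j))"
    using assms by simp
  then show ?thesis unfolding gen_def by (intro CollectI exI)
qed

text \<open>Nakayama's argument over the localisation of \<open>k[X]\<close> at \<open>X\<close>: if \<open>X - 1\<close> is onto, the generators
  can be eliminated one at a time, multiplying each time by a polynomial that does not vanish at 1.\<close>
lemma torsion_of_finitely_generated:
  assumes "finite I" "\<And>i. i \<in> I \<Longrightarrow> e i \<in> V"
    and inj: "\<And>v. v \<in> V \<Longrightarrow> X v = 0 \<Longrightarrow> v = 0"
    and surj: "\<And>v. v \<in> V \<Longrightarrow> \<exists>u\<in>V. v = X u - u"
    and "poly p 1 \<noteq> 0" "\<And>v. v \<in> V \<Longrightarrow> \<exists>N. papp ([:0, 1:] ^ N * p) v \<in> gen I e"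
  shows "\<exists>p. p \<noteq> 0 \<and> (\<forall>v\<in>V. papp p v = 0)"
  using assms(1,2,5,6)
proof (induction I arbitrary: p)
  case empty
  \<comment> \<open>With no generators left, X^N p kills v; injectivity of X removes the power
    X^N.\<close>
  have inj_pow: "v = 0" if "v \<in> V" "(X ^^ N) v = 0" for N v
    using that
  proof (induction N)
    case (Suc N)
    have "(X ^^ N) v \<in> V"
      using Suc.prems(1) by (induction N) (auto simp: X_in)
    with Suc inj show ?case by simp
  qed simp
  have "papp p v = 0" if "v \<in> V" for v
    using empty.prems(3)[OF that] that
    by (auto simp: gen_def papp_mult papp_X_power intro: inj_pow papp_in)
  moreover have "p \<noteq> 0" using empty.prems(2) by auto
  ultimately show ?case by blast
next
  case (insert i I)
  have eV: "e i \<in> V" "\<And>j. j \<in> I \<Longrightarrow> e j \<in> V"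
    using insert.prems(1) by auto
  obtain u where u: "u \<in> V" "e i = X u - u"
    using surj eV by blast
  obtain N q where q: "papp ([:0, 1:] ^ N * p) u = papp (q i) (e i) + (\<Sum>j\<in>I. papp (q j) (e j))"
    using insert.prems(3)[OF u(1)] insert.hyps by (auto simp: gen_def)
  \<comment> \<open>Applying X - 1 to X^N p u = q_i e_i + rest, with e_i = (X - 1) u, gives p' e_i =
    (X - 1) rest, free of e_i. At 1 the correction vanishes and X^N is 1, so p'(1) = p(1).\<close>
  define p' where "p' = [:0, 1:] ^ N * p - [:-1, 1:] * q i"
  have eu: "e i = papp [:-1, 1:] u"
    using u by (simp add: papp_linear)
  have "papp ([:0, 1:] ^ N * p) (e i) = papp [:-1, 1:] (papp ([:0, 1:] ^ N * p) u)"
    unfolding eu using u(1) by (simp only: papp_mult[symmetric] mult.commute)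
  also have "\<dots> = papp [:-1, 1:] (papp (q i) (e i)) + papp [:-1, 1:] (\<Sum>j\<in>I. papp (q j) (e j))"
    unfolding q using eV by (simp add: papp_vadd papp_in V_sum)
  finally have "papp p' (e i) = papp [:-1, 1:] (\<Sum>j\<in>I. papp (q j) (e j))"
    unfolding p'_def papp_diff[OF eV(1)] by (simp only: papp_mult[OF eV(1)]) simp
  moreover have sum_gen: "(\<Sum>j\<in>I. papp (q j) (e j)) \<in> gen I e" for q
    by (auto simp: gen_def)
  ultimately have p'e: "papp p' (e i) \<in> gen I e"
    using gen_papp[of I e, OF eV(2)] by simp
  \<comment> \<open>The new multiplier: p, with a power of X, brings v into the span of all
    generators, and p' then eliminates e i.\<close>
  have "poly (p' * p) 1 \<noteq> 0"
    using insert.prems(2) by (simp add: p'_def)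
  moreover have "\<exists>N. papp ([:0, 1:] ^ N * (p' * p)) v \<in> gen I e" if v: "v \<in> V" for v
  proof -
    obtain N q where q: "papp ([:0, 1:] ^ N * p) v = papp (q i) (e i) + (\<Sum>j\<in>I. papp (q j) (e j))"
      using insert.prems(3)[OF v] insert.hyps by (auto simp: gen_def)
    have "papp ([:0, 1:] ^ N * (p' * p)) v = papp p' (papp ([:0, 1:] ^ N * p) v)"
      using v by (simp only: papp_mult[symmetric] mult.left_commute)
    also have "\<dots> = papp (q i) (papp p' (e i)) + papp p' (\<Sum>j\<in>I. papp (q j) (e j))"
      unfolding q using eV
      by (simp add: papp_vadd papp_in V_sum papp_mult[symmetric] mult.commute)
    also have "\<dots> \<in> gen I e"
      by (intro gen_add[of I e] gen_papp[of I e, OF eV(2) p'e] gen_papp[of I e, OF eV(2) sum_gen] eV(2))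
    finally show ?thesis by blast
  qed
  ultimately show ?case
    using insert.IH[of "p' * p"] eV by blast
qed

text \<open>Applying X - \<mu> s removes the summand at s and rescales the others by nonzero
  factors.\<close>

lemma eigenvectors_sum_eq_0:
  assumes "finite K" "inj_on \<mu> K" "\<And>k. k \<in> K \<Longrightarrow> u k \<in> V" "\<And>k. k \<in> K \<Longrightarrow> X (u k) = sc (\<mu> k) (u k)"
    "(\<Sum>k\<in>K. u k) = 0" "k \<in> K"
  shows "u k = 0"
  using assms
proof (induction K arbitrary: u k rule: finite_induct)
  case (insert s K)
  have sum: "u s + (\<Sum>k\<in>K. u k) = 0"
    using insert.prems(4) insert.hyps by simp
  have "(\<Sum>k\<in>K. sc (\<mu> k - \<mu> s) (u k)) = papp [:- \<mu> s, 1:] (u s + (\<Sum>k\<in>K. u k))"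
    using insert.prems(2,3)
    by (simp add: papp_vadd V_sum papp_vsum papp_linear vs.scale_left_diff_distrib)
  then have "(\<Sum>k\<in>K. sc (\<mu> k - \<mu> s) (u k)) = 0"
    by (simp add: sum papp_vzero)
  then have *: "sc (\<mu> k - \<mu> s) (u k) = 0" if "k \<in> K" for k
    using insert.IH[of "\<lambda>k. sc (\<mu> k - \<mu> s) (u k)" k] insert.prems(1-3) that
    by (simp add: V_scale X_scale mult.commute inj_on_insert)
  then have K: "u k = 0" if "k \<in> K" for k
  proof -
    have "\<mu> k - \<mu> s \<noteq> 0"
      using insert.prems(1) insert.hyps that by (auto simp: inj_on_def)
    with * [OF that] show ?thesis by simp
  qed
  then have "u s = 0"
    using sum by simp
  with K insert.prems(5) show ?case by auto
qed simp

end

section \<open>Yetter-Drinfeld modules\<close>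

lemma (in liu_algebra) hmul_sum_left: "hmul (sum f A) c = (\<Sum>x\<in>A. hmul (f x) c)"
  by (induction A rule: infinite_finite_induct) (simp_all add: hmul_add_left)

lemma (in liu_algebra) hmul_sum_right: "hmul c (sum f A) = (\<Sum>x\<in>A. hmul c (f x))"
  by (induction A rule: infinite_finite_induct) (simp_all add: hmul_add_right)

text \<open>The compatibility axiom only multiplies by basis elements; this turns such a sum back
  into a product with c.\<close>

lemma (in liu_algebra) lookup_hmul_expand:
  assumes "finite K" "Poly_Mapping.keys c \<subseteq> K"
  shows "Poly_Mapping.lookup (hmul a (hmul c d)) p
    = (\<Sum>b\<in>K. Poly_Mapping.lookup c b * Poly_Mapping.lookup (hmul a (hmul (bas b) d)) p)"
proof -
  have c: "(\<Sum>b\<in>K. psc (Poly_Mapping.lookup c b) (bas b)) = c"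
    using poly_mapping_sum_single[of c] sum_keys_superset[of K c Poly_Mapping.single] assms
    by (simp add: bas_def)
  have "hmul a (hmul (\<Sum>b\<in>K. psc (f b) (bas b)) d) = (\<Sum>b\<in>K. psc (f b) (hmul a (hmul (bas b) d)))" for f
    by (simp add: hmul_sum_left hmul_sum_right hmul_psc_left hmul_psc_right)
  from this[of "Poly_Mapping.lookup c"]
  have "hmul a (hmul c d) = (\<Sum>b\<in>K. psc (Poly_Mapping.lookup c b) (hmul a (hmul (bas b) d)))"
    by (simp only: c)
  then show ?thesis
    by (simp add: lookup_sum)
qed

lemma (in liu_algebra) hmul_hone_left: "h \<in> Hcar \<Longrightarrow> hmul hone h = h"
proof (induction rule: Hcar_induct)
  case (bas c b)
  then show ?case
    by (cases b) (simp add: bas_mono hmul_psc_right hone_def hmul_mono)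
qed (simp_all add: hmul_add_right)

locale yd_module = liu_algebra n w \<gamma> for n w :: nat and \<gamma> :: "'k::field" +
  fixes sc :: "'k \<Rightarrow> 'v::ab_group_add \<Rightarrow> 'v" and V act \<delta>
  assumes YD: "is_YD sc V act \<delta>"
begin

sublocale vs: vector_space sc
  using YD by (simp add: is_YD_def)

lemma subspace_V: "vs.subspace V"
  using YD by (simp add: is_YD_def)

lemmas V_zero = vs.subspace_0[OF subspace_V]
  and V_add = vs.subspace_add[OF subspace_V]
  and V_scale = vs.subspace_scale[OF subspace_V]
  and V_diff = vs.subspace_diff[OF subspace_V]
  and V_sum = vs.subspace_sum[OF subspace_V]

lemma act_in: "h \<in> Hcar \<Longrightarrow> v \<in> V \<Longrightarrow> act h v \<in> V"
  and act_vadd: "h \<in> Hcar \<Longrightarrow> u \<in> V \<Longrightarrow> v \<in> V \<Longrightarrow> act h (u + v) = act h u + act h v"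
  and act_scale: "h \<in> Hcar \<Longrightarrow> v \<in> V \<Longrightarrow> act h (sc c v) = sc c (act h v)"
  and act_add: "a \<in> Hcar \<Longrightarrow> b \<in> Hcar \<Longrightarrow> v \<in> V \<Longrightarrow> act (a + b) v = act a v + act b v"
  and act_psc: "a \<in> Hcar \<Longrightarrow> v \<in> V \<Longrightarrow> act (psc c a) v = sc c (act a v)"
  and act_hmul: "a \<in> Hcar \<Longrightarrow> b \<in> Hcar \<Longrightarrow> v \<in> V \<Longrightarrow> act (hmul a b) v = act a (act b v)"
  and act_hone: "v \<in> V \<Longrightarrow> act hone v = v"
  using YD by (simp_all add: is_YD_def)

lemma act_vzero: "h \<in> Hcar \<Longrightarrow> act h 0 = 0"
  using act_scale[of h 0 0] V_zero by simp

lemma act_vdiff: "h \<in> Hcar \<Longrightarrow> u \<in> V \<Longrightarrow> v \<in> V \<Longrightarrow> act h (u - v) = act h u - act h v"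
  using act_vadd[of h "u - v" v] by (simp add: V_diff)

lemma act_zero: "v \<in> V \<Longrightarrow> act 0 v = 0"
  using act_psc[of 0 v 0] by simp

lemma act_vsum: "h \<in> Hcar \<Longrightarrow> (\<And>i. i \<in> I \<Longrightarrow> f i \<in> V) \<Longrightarrow> act h (sum f I) = (\<Sum>i\<in>I. act h (f i))"
  by (induction I rule: infinite_finite_induct) (simp_all add: act_vzero act_vadd V_sum)

lemma operator_on_act: "h \<in> Hcar \<Longrightarrow> operator_on sc V (act h)"
  by unfold_locales (simp_all add: subspace_V act_in act_vadd act_scale)

text \<open>Splits the coaction into a family of linear maps from V to V, one for each PBW basis
  element.\<close>

definition co :: "'v \<Rightarrow> bidx \<Rightarrow> 'v" where
  "co v b = Poly_Mapping.lookup (\<delta> v) b"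

lemma co_in: "v \<in> V \<Longrightarrow> co v b \<in> V"
  using YD unfolding is_YD_def co_def by blast

lemma co_invalid: "v \<in> V \<Longrightarrow> \<not> valid b \<Longrightarrow> co v b = 0"
proof -
  assume "v \<in> V" "\<not> valid b"
  moreover from this(1) have "Poly_Mapping.keys (\<delta> v) \<subseteq> {b. valid b}"
    using YD by (simp add: is_YD_def)
  ultimately show ?thesis by (auto simp: co_def in_keys_iff)
qed

lemma co_add: "u \<in> V \<Longrightarrow> v \<in> V \<Longrightarrow> co (u + v) b = co u b + co v b"
  using YD unfolding is_YD_def co_def by (simp add: lookup_add)

lemma co_diff: "u \<in> V \<Longrightarrow> v \<in> V \<Longrightarrow> co (u - v) b = co u b - co v b"
  using co_add[of "u - v" v] by (simp add: V_diff)

lemma co_scale: "v \<in> V \<Longrightarrow> co (sc c v) b = sc c (co v b)"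
  using YD unfolding is_YD_def co_def by (simp add: lookup_pmapV)

lemma co_zero: "co 0 b = 0"
  using co_scale[of 0 0] V_zero by simp

lemma co_sum: "(\<And>i. i \<in> I \<Longrightarrow> f i \<in> V) \<Longrightarrow> co (sum f I) b = (\<Sum>i\<in>I. co (f i) b)"
  by (induction I rule: infinite_finite_induct) (simp_all add: co_zero co_add V_sum)

lemma counit: "v \<in> V \<Longrightarrow> (\<Sum>b\<in>Poly_Mapping.keys (\<delta> v). sc (beps b) (co v b)) = v"
  using YD unfolding is_YD_def co_def by blast

lemma coassoc:
  assumes "v \<in> V"
  shows "(\<Sum>b'\<in>Poly_Mapping.keys (\<delta> v). sc (Poly_Mapping.lookup (Dbasis b') (b, q)) (co v b')) = co (co v b) q"
proof -
  have "(\<Sum>b'\<in>Poly_Mapping.keys (\<delta> v). \<Sum>Q\<in>Poly_Mapping.keys (Dbasis b').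
           Poly_Mapping.single Q (sc (Poly_Mapping.lookup (Dbasis b') Q) (co v b')))
      = (\<Sum>b'\<in>Poly_Mapping.keys (\<delta> v). \<Sum>q\<in>Poly_Mapping.keys (\<delta> (co v b')).
           Poly_Mapping.single (b', q) (co (co v b') q))"
    (is "?L = ?R")
    using YD assms unfolding is_YD_def co_def by (elim conjE) (erule bspec, assumption)
  then have LR: "Poly_Mapping.lookup ?L (b, q) = Poly_Mapping.lookup ?R (b, q)"
    by (rule arg_cong)
  have L: "Poly_Mapping.lookup ?L (b, q)
      = (\<Sum>b'\<in>Poly_Mapping.keys (\<delta> v). sc (Poly_Mapping.lookup (Dbasis b') (b, q)) (co v b'))"
  proof -
    have "Poly_Mapping.lookup (\<Sum>Q\<in>Poly_Mapping.keys (Dbasis b').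
           Poly_Mapping.single Q (sc (Poly_Mapping.lookup (Dbasis b') Q) (co v b'))) (b, q)
       = sc (Poly_Mapping.lookup (Dbasis b') (b, q)) (co v b')" for b'
      using lookup_tensV[of sc "Dbasis b'" "co v b'" "(b, q)"] by (simp add: tensV_def)
    then show ?thesis by (simp add: lookup_sum)
  qed
  have R: "Poly_Mapping.lookup ?R (b, q) = co (co v b) q"
  proof -
    have "Poly_Mapping.lookup (\<Sum>q\<in>Poly_Mapping.keys (\<delta> (co v b')). Poly_Mapping.single (b', q) (co (co v b') q)) (b, q)
        = (if b' = b then co (co v b) q else 0)" for b'
    proof -
      have "Poly_Mapping.lookup (\<Sum>q\<in>Poly_Mapping.keys (\<delta> (co v b')). Poly_Mapping.single (b', q) (co (co v b') q)) (b, q)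
        = (\<Sum>q'\<in>Poly_Mapping.keys (\<delta> (co v b')). if q' = q then if b' = b then co (co v b) q else 0 else 0)"
        unfolding lookup_sum by (rule sum.cong) (auto simp: lookup_single when_def)
      also have "\<dots> = (if b' = b then co (co v b) q else 0)"
        by (auto simp: co_def in_keys_iff)
      finally show ?thesis .
    qed
    then have "Poly_Mapping.lookup ?R (b, q) = (\<Sum>b'\<in>Poly_Mapping.keys (\<delta> v). if b' = b then co (co v b) q else 0)"
      by (simp add: lookup_sum)
    also have "\<dots> = co (co v b) q"
      using co_zero by (auto simp: co_def in_keys_iff)
    finally show ?thesis .
  qed
  show ?thesis
    by (rule trans[OF L[symmetric] trans[OF LR R]])
qed

lemma co_act:
  assumes "h \<in> Hcar" "v \<in> V"
  shows "co (act h v) p = (\<Sum>T\<in>Poly_Mapping.keys (hDelta2 h). \<Sum>b\<in>Poly_Mapping.keys (\<delta> v).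
      sc (Poly_Mapping.lookup (hDelta2 h) T
          * Poly_Mapping.lookup (hmul (bas (fst T)) (hmul (bas b) (Sbasis (snd (snd T))))) p)
         (act (bas (fst (snd T))) (co v b)))"
proof -
  have "\<delta> (act h v) = (\<Sum>T\<in>Poly_Mapping.keys (hDelta2 h). \<Sum>b\<in>Poly_Mapping.keys (\<delta> v).
           tensV sc (psc (Poly_Mapping.lookup (hDelta2 h) T) (hmul (bas (fst T)) (hmul (bas b) (Sbasis (snd (snd T))))))
                 (act (bas (fst (snd T))) (Poly_Mapping.lookup (\<delta> v) b)))"
    using YD assms unfolding is_YD_def by (elim conjE) (drule bspec[of Hcar], assumption, erule bspec, assumption)
  then show ?thesis
    by (simp add: co_def lookup_sum lookup_tensV)
qed

text \<open>Lets the compatibility formula be evaluated on any presentation \<delta> v = sum of c l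
  \<otimes> u l, where the c l need not be basis elements.\<close>

lemma coaction_expand:
  assumes "v \<in> V" "h \<in> Hcar" "finite S" "\<And>l. l \<in> S \<Longrightarrow> u l \<in> V"
    "\<And>b. co v b = (\<Sum>l\<in>S. sc (Poly_Mapping.lookup (c l) b) (u l))"
  shows "(\<Sum>b\<in>Poly_Mapping.keys (\<delta> v). sc (Poly_Mapping.lookup (hmul a (hmul (bas b) d)) p) (act h (co v b)))
    = (\<Sum>l\<in>S. sc (Poly_Mapping.lookup (hmul a (hmul (c l) d)) p) (act h (u l)))"
proof -
  define K where "K = Poly_Mapping.keys (\<delta> v) \<union> (\<Union>l\<in>S. Poly_Mapping.keys (c l))"
  have K: "finite K" using assms(3) by (simp add: K_def)
  have 1: "act h (co v b) = (\<Sum>l\<in>S. sc (Poly_Mapping.lookup (c l) b) (act h (u l)))" for b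
    unfolding assms(5) using assms(2,4) by (simp add: act_vsum act_scale V_scale)
  have "(\<Sum>b\<in>Poly_Mapping.keys (\<delta> v). sc (Poly_Mapping.lookup (hmul a (hmul (bas b) d)) p) (act h (co v b)))
      = (\<Sum>b\<in>K. sc (Poly_Mapping.lookup (hmul a (hmul (bas b) d)) p) (act h (co v b)))"
    by (rule sum.mono_neutral_left) (use K in \<open>auto simp: K_def co_def in_keys_iff act_vzero assms(2)\<close>)
  also have "\<dots> = (\<Sum>b\<in>K. \<Sum>l\<in>S. sc (Poly_Mapping.lookup (c l) b * Poly_Mapping.lookup (hmul a (hmul (bas b) d)) p) (act h (u l)))"
    unfolding 1 vs.scale_sum_right by (simp add: mult.commute)
  also have "\<dots> = (\<Sum>l\<in>S. \<Sum>b\<in>K. sc (Poly_Mapping.lookup (c l) b * Poly_Mapping.lookup (hmul a (hmul (bas b) d)) p) (act h (u l)))"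
    by (rule sum.swap)
  also have "\<dots> = (\<Sum>l\<in>S. sc (Poly_Mapping.lookup (hmul a (hmul (c l) d)) p) (act h (u l)))"
  proof (rule sum.cong[OF refl])
    fix l assume "l \<in> S"
    then have "Poly_Mapping.keys (c l) \<subseteq> K" by (auto simp: K_def)
    then show "(\<Sum>b\<in>K. sc (Poly_Mapping.lookup (c l) b * Poly_Mapping.lookup (hmul a (hmul (bas b) d)) p) (act h (u l)))
      = sc (Poly_Mapping.lookup (hmul a (hmul (c l) d)) p) (act h (u l))"
      by (simp add: lookup_hmul_expand[OF K] vs.scale_sum_left)
  qed
  finally show ?thesis .
qed

lemma co_act_grouplike:
  assumes "v \<in> V" "i < n"
  shows "co (act (bas (r, i, 0)) v) p = (\<Sum>b\<in>Poly_Mapping.keys (\<delta> v).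
      sc (Poly_Mapping.lookup (hmul (bas (r, i, 0)) (hmul (bas b) (mono (- r) (- int i) 0))) p)
         (act (bas (r, i, 0)) (co v b)))"
proof -
  have "valid (r, i, 0)" using assms(2) by (simp add: valid_def)
  then show ?thesis
    using assms by (simp add: co_act hDelta2_grouplike Sbasis_grouplike)
qed

text \<open>The three summands come from the iterated coproduct y \<otimes> g \<otimes> g + 1
  \<otimes> y \<otimes> g + 1 \<otimes> 1 \<otimes> y. When the u l form a chain of g-eigenvectors
  shifted by y, this is the recursion of the elements c(k,l).\<close>

lemma co_act_y:
  assumes "1 < n" "v \<in> V" "finite S" "\<And>l. l \<in> S \<Longrightarrow> u l \<in> V" "\<And>l. l \<in> S \<Longrightarrow> c l \<in> Hcar"
    "\<And>b. co v b = (\<Sum>l\<in>S. sc (Poly_Mapping.lookup (c l) b) (u l))"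
  shows "co (act hy v) p = (\<Sum>l\<in>S. sc (Poly_Mapping.lookup (hmul hy (hmul (c l) Sg)) p) (act hg (u l))
     + sc (Poly_Mapping.lookup (hmul (c l) Sg) p) (act hy (u l)) + sc (Poly_Mapping.lookup (hmul (c l) Sy) p) (u l))"
proof -
  have bas: "bas (0, 0, 1) = hy" "bas (0, 1, 0) = hg" "bas (0, 0, 0) = hone"
    using assms(1) by (simp_all add: hy_def hg_def hone_def mono_low)
  have S: "Sbasis (0, 1, 0) = Sg"
    by (simp add: Sbasis_grouplike Sg_def)
  have car: "hy \<in> Hcar" "hg \<in> Hcar" "hone \<in> Hcar" "Sg \<in> Hcar" "Sy \<in> Hcar"
    by (simp_all add: hy_def hg_def hone_def Sg_def Sy_eq)
  let ?F = "\<lambda>T s. \<Sum>b\<in>Poly_Mapping.keys (\<delta> v). sc (s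
          * Poly_Mapping.lookup (hmul (bas (fst T)) (hmul (bas b) (Sbasis (snd (snd T))))) p)
         (act (bas (fst (snd T))) (co v b))"
  have F: "?F T 0 = 0" "?F T (s + t) = ?F T s + ?F T t" for T s t
    by (simp_all add: distrib_right vs.scale_left_distrib sum.distrib)
  have "co (act hy v) p = (\<Sum>T\<in>Poly_Mapping.keys (hDelta2 hy). ?F T (Poly_Mapping.lookup (hDelta2 hy) T))"
    by (rule co_act) (use assms car in auto)
  also have "\<dots> = ?F ((0, 0, 1), (0, 1, 0), (0, 1, 0)) 1 + ?F ((0, 0, 0), (0, 0, 1), (0, 1, 0)) 1
      + ?F ((0, 0, 0), (0, 0, 0), (0, 0, 1)) 1"
    unfolding bas(1)[symmetric] hDelta2_y[OF assms(1)]
    by (subst sum_keys_add[where F = ?F, OF F], subst sum_keys_add[where F = ?F, OF F])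
      (simp only: sum_keys_single[where F = ?F, OF F(1)])
  also have "\<dots> = (\<Sum>l\<in>S. sc (Poly_Mapping.lookup (hmul hy (hmul (c l) Sg)) p) (act hg (u l)))
     + (\<Sum>l\<in>S. sc (Poly_Mapping.lookup (hmul hone (hmul (c l) Sg)) p) (act hy (u l)))
     + (\<Sum>l\<in>S. sc (Poly_Mapping.lookup (hmul hone (hmul (c l) Sy)) p) (act hone (u l)))"
    unfolding fst_conv snd_conv bas S Sbasis_y mult_1
    by (simp only: coaction_expand[where S = S and u = u and c = c, OF assms(2) _ assms(3,4,6)] car)
  also have "\<dots> = (\<Sum>l\<in>S. sc (Poly_Mapping.lookup (hmul hy (hmul (c l) Sg)) p) (act hg (u l))
     + sc (Poly_Mapping.lookup (hmul (c l) Sg) p) (act hy (u l)) + sc (Poly_Mapping.lookup (hmul (c l) Sy) p) (u l))"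
    using assms(4,5) car by (simp add: sum.distrib hmul_hone_left act_hone)
  finally show ?thesis .
qed

text \<open>Conjugation by the central element x fixes every basis element.\<close>

lemma co_act_x:
  assumes "v \<in> V" shows "co (act hx v) p = act hx (co v p)"
proof -
  have hx: "hx = bas (1, 0, 0)" "hx \<in> Hcar"
    using n_pos by (simp add: hx_def mono_low, simp add: hx_def)
  have "co (act hx v) p = (\<Sum>b\<in>Poly_Mapping.keys (\<delta> v). sc (Poly_Mapping.lookup (hmul hx (hmul (bas b) hxinv)) p) (act hx (co v b)))"
    unfolding hx(1) using co_act_grouplike[OF assms n_pos, of 1 p] by (simp add: hxinv_def)
  also have "\<dots> = (\<Sum>b\<in>Poly_Mapping.keys (\<delta> v). if b = p then act hx (co v p) else 0)"
  proof (rule sum.cong[OF refl])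
    fix b assume "b \<in> Poly_Mapping.keys (\<delta> v)"
    then have "valid b" using co_invalid[OF assms, of b] by (auto simp: in_keys_iff co_def)
    then have conj: "hmul hx (hmul (bas b) hxinv) = bas b"
      by (cases b) (simp add: bas_mono hx_def hxinv_def hmul_mono)
    then show "sc (Poly_Mapping.lookup (hmul hx (hmul (bas b) hxinv)) p) (act hx (co v b)) = (if b = p then act hx (co v p) else 0)"
      unfolding conj by (simp add: bas_def lookup_single)
  qed
  also have "\<dots> = act hx (co v p)"
    using act_vzero[OF hx(2)] by (cases "p \<in> Poly_Mapping.keys (\<delta> v)") (simp_all add: co_def in_keys_iff)
  finally show ?thesis .
qed

section \<open>Vectors with grouplike coaction\<close>

definition gl :: "int \<Rightarrow> int \<Rightarrow> 'v set" where
  "gl r i = {v \<in> V. \<forall>p. co v p = sc (Poly_Mapping.lookup (mono r i 0) p) v}"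

lemma subspace_gl: "vs.subspace (gl r i)"
  by (rule vs.subspaceI)
    (auto simp: gl_def V_zero V_add V_scale co_zero co_add co_scale vs.scale_right_distrib mult.commute)

text \<open>The grouplike elements x^a g^b and x^r g^i commute, so the conjugation in the
  compatibility formula is trivial.\<close>

lemma gl_act_grouplike:
  assumes "v \<in> gl r i" "b < n"
  shows "act (bas (a, b, 0)) v \<in> gl r i"
proof -
  have v: "v \<in> V" "\<And>p. co v p = (\<Sum>l\<in>{()}. sc (Poly_Mapping.lookup (mono r i 0) p) v)"
    using assms(1) by (auto simp: gl_def)
  have val: "valid (a, b, 0)" using assms(2) by (simp add: valid_def)
  have "hmul (bas (a, b, 0)) (hmul (mono r i 0) (mono (- a) (- int b) 0)) = mono r i 0"
    using val by (simp add: bas_mono hmul_mono)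
  then have "co (act (bas (a, b, 0)) v) p = sc (Poly_Mapping.lookup (mono r i 0) p) (act (bas (a, b, 0)) v)" for p
    unfolding co_act_grouplike[OF v(1) assms(2)]
    using coaction_expand[OF v(1), of "bas (a, b, 0)" "{()}" "\<lambda>_. v" "\<lambda>_. mono r i 0"] v val by simp
  then show ?thesis
    using v(1) val by (simp add: gl_def act_in)
qed

lemma gl_act_g:
  assumes "v \<in> gl r i" shows "act hg v \<in> gl r i"
proof -
  \<comment> \<open>The index is written with div and mod because g is x^w when n = 1.\<close>
  have "hg = bas (int w * (1 div int n), nat (1 mod int n), 0)" "nat (1 mod int n) < n"
    using n_pos by (simp_all add: hg_def mono_low nat_less_iff)
  with gl_act_grouplike[OF assms] show ?thesis by metis
qed

text \<open>A coefficient of \<open>\<delta> v\<close> at a basis element of maximal \<open>y\<close>-degree is a grouplike vector: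
  by coassociativity only the leading term of the coproduct contributes to its coaction.\<close>
lemma exists_grouplike_vector:
  assumes "V \<noteq> {0}"
  shows "\<exists>r i v. v \<in> gl r i \<and> v \<noteq> 0"
proof -
  obtain v where v: "v \<in> V" "v \<noteq> 0" using assms V_zero by blast
  have "Poly_Mapping.keys (\<delta> v) \<noteq> {}"
    using counit[OF v(1)] v(2) by auto
  then have "Max ((snd \<circ> snd) ` Poly_Mapping.keys (\<delta> v)) \<in> (snd \<circ> snd) ` Poly_Mapping.keys (\<delta> v)"
    by (intro Max_in) simp_all
  then obtain b where b: "b \<in> Poly_Mapping.keys (\<delta> v)" "snd (snd b) = Max ((snd \<circ> snd) ` Poly_Mapping.keys (\<delta> v))"
    by auto
  then have max: "snd (snd b') \<le> snd (snd b)" if "b' \<in> Poly_Mapping.keys (\<delta> v)" for b'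
    using Max_ge[of "(snd \<circ> snd) ` Poly_Mapping.keys (\<delta> v)" "snd (snd b')"] that by auto
  have valid: "valid b'" if "b' \<in> Poly_Mapping.keys (\<delta> v)" for b'
    using co_invalid[OF v(1), of b'] that by (auto simp: in_keys_iff co_def)
  define g where "g = (mono (fst b) (int (fst (snd b)) + int (snd (snd b))) 0 :: 'k hel)"
  have "co (co v b) q = sc (Poly_Mapping.lookup g q) (co v b)" for q
  proof -
    have "co (co v b) q = (\<Sum>b'\<in>Poly_Mapping.keys (\<delta> v). if b' = b then sc (Poly_Mapping.lookup g q) (co v b) else 0)"
      unfolding coassoc[OF v(1), symmetric]
      by (rule sum.cong[OF refl]) (use b(1) max valid in \<open>auto simp: lookup_Dbasis_top g_def\<close>)
    then show ?thesis using b(1) by simp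
  qed
  moreover have "co v b \<noteq> 0"
    using b(1) by (simp add: co_def in_keys_iff)
  moreover from calculation(1) have "co v b \<in> gl (fst b) (int (fst (snd b)) + int (snd (snd b)))"
    using co_in[OF v(1)] by (simp add: gl_def g_def)
  ultimately show ?thesis by blast
qed

lemma gens_in_Hcar [simp]: "hx \<in> Hcar" "hg \<in> Hcar" "hy \<in> Hcar" "hone \<in> Hcar"
  by (simp_all add: hx_def hg_def hy_def hone_def)

lemma act_mono_mono:
  "v \<in> V \<Longrightarrow> act (mono a b c) (act (mono a' b' c') v) = sc (\<gamma> powi (int c * b')) (act (mono (a + a') (b + b') (c + c')) v)"
  using act_hmul[of "mono a b c" "mono a' b' c'" v] by (simp add: hmul_mono act_psc)

lemma act_mono_0: "v \<in> V \<Longrightarrow> act (mono 0 0 0) v = v"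
  using act_hone by (simp add: hone_def)

lemma act_mono_split: "v \<in> V \<Longrightarrow> act (mono a b c) v = act (mono a 0 0) (act (mono 0 b 0) (act (mono 0 0 c) v))"
  by (simp add: act_mono_mono act_in)

lemma act_hy_pow: "v \<in> V \<Longrightarrow> (act hy ^^ k) v = act (mono 0 0 k) v"
  by (induction k) (simp_all add: act_mono_0 hy_def act_mono_mono)

lemma act_hg_pow: "v \<in> V \<Longrightarrow> (act hg ^^ k) v = act (mono 0 (int k) 0) v"
  by (induction k) (simp_all add: act_mono_0 hg_def act_mono_mono)

lemma act_hx_pow: "v \<in> V \<Longrightarrow> (act hx ^^ k) v = act (mono (int k) 0 0) v"
  by (induction k) (simp_all add: act_mono_0 hx_def act_mono_mono)

lemma act_hx_commute: "h \<in> Hcar \<Longrightarrow> v \<in> V \<Longrightarrow> act hx (act h v) = act h (act hx v)"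
  by (simp add: act_hmul[symmetric] hmul_hx_commute)

lemma act_hg_hy: "v \<in> V \<Longrightarrow> act hg (act hy v) = sc (inverse \<gamma>) (act hy (act hg v))"
  by (simp add: hg_def hy_def act_mono_mono)

lemma powers_in:
  assumes "h \<in> Hcar" "v \<in> V" shows "(act h ^^ k) v \<in> V"
  by (induction k) (simp_all add: assms act_in)

text \<open>Reduces closure of a span under an operator to its spanning vectors; the next lemma does
  the same for the coaction.\<close>

lemma subspace_act_preimage:
  assumes "h \<in> Hcar" "vs.subspace W"
  shows "vs.subspace {u \<in> V. act h u \<in> W}"
  using assms(1) vs.subspace_0[OF assms(2)] vs.subspace_add[OF assms(2)] vs.subspace_scale[OF assms(2)]
  by (intro vs.subspaceI) (auto simp: V_zero V_add V_scale act_vzero act_vadd act_scale)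

lemma subspace_co_preimage:
  assumes "vs.subspace W"
  shows "vs.subspace {u \<in> V. co u p \<in> W}"
  using vs.subspace_0[OF assms] vs.subspace_add[OF assms] vs.subspace_scale[OF assms]
  by (intro vs.subspaceI) (auto simp: V_zero V_add V_scale co_zero co_add co_scale)

text \<open>A basis element acts as a power of y, then of g, then of x. Only x occurs with negative
  exponents, so its powers are assumed directly.\<close>

lemma act_closed_of_generators:
  assumes W: "W \<subseteq> V" "vs.subspace W"
    and gen: "\<And>u. u \<in> W \<Longrightarrow> act hg u \<in> W" "\<And>u. u \<in> W \<Longrightarrow> act hy u \<in> W" "\<And>a u. u \<in> W \<Longrightarrow> act (mono a 0 0) u \<in> W"
    and "h \<in> Hcar" "u \<in> W"
  shows "act h u \<in> W"
  using assms(6)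
proof (induction rule: Hcar_induct)
  case zero
  then show ?case using W assms(7) vs.subspace_0 by (auto simp: act_zero)
next
  case (bas c b)
  obtain r i j where b: "b = (r, i, j)" by (cases b)
  have y: "act (mono 0 0 k) u \<in> W" for k
  proof -
    have "(act hy ^^ k) u \<in> W" by (induction k) (use assms(7) gen in auto)
    then show ?thesis using W assms(7) by (auto simp: act_hy_pow)
  qed
  have g: "act (mono 0 (int k) 0) z \<in> W" if "z \<in> W" for k z
  proof -
    have "(act hg ^^ k) z \<in> W" by (induction k) (use that gen in auto)
    then show ?thesis using W that by (auto simp: act_hg_pow)
  qed
  have uV: "u \<in> V" using W assms(7) by auto
  have "act (mono r (int i) j) u \<in> W"
    unfolding act_mono_split[OF uV, of r "int i" j] by (intro gen(3) g y)
  with bas uV show ?case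
    by (simp add: b bas_mono act_psc vs.subspace_scale[OF W(2)])
next
  case (add a b)
  then show ?case using W assms(7) vs.subspace_add by (auto simp: act_add)
qed

text \<open>On grouplike vectors of a fixed type g is an operator whose n-th power is x^w =
  \<alpha>^w. So T^n - \<alpha>^w annihilates v, an eigenvector exists, and its eigenvalue is a
  root.\<close>

lemma exists_gl_eigenvector:
  assumes "alg_closed TYPE('k)" "V \<noteq> {0}" "\<alpha> \<noteq> 0" "\<And>v. v \<in> V \<Longrightarrow> act hx v = sc \<alpha> v"
  obtains r i v \<beta> where "v \<in> gl r i" "v \<noteq> 0" "act hg v = sc \<beta> v" "\<beta> \<noteq> 0" "\<alpha> ^ w = \<beta> ^ n"
proof -
  obtain r i v where v: "v \<in> gl r i" "v \<noteq> 0"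
    using exists_grouplike_vector assms(2) by blast
  have glV: "u \<in> V" if "u \<in> gl r i" for u using that by (simp add: gl_def)
  interpret G: operator_on sc "gl r i" "act hg"
    by unfold_locales (use subspace_gl gl_act_g glV in \<open>auto simp: act_vadd act_scale\<close>)
  have pow: "(act hx ^^ k) u = sc (\<alpha> ^ k) u" if "u \<in> V" for k u
    by (induction k) (simp_all add: act_scale assms(4) that mult.commute V_scale)
  have gn: "(act hg ^^ n) u = sc (\<alpha> ^ w) u" if "u \<in> V" for u
    using pow[OF that, of w] that mono_shift_g[of 0 0 1 0] by (simp add: act_hg_pow act_hx_pow)
  define p where "p = [:0, 1:] ^ n - [:\<alpha> ^ w:]"
  have "poly p 0 \<noteq> 0"
    using assms(3) n_pos by (simp add: p_def zero_power)
  then have "p \<noteq> 0" by auto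
  moreover have "G.papp p v = 0"
    using v glV gn by (simp add: p_def G.papp_diff G.papp_X_power G.papp_pCons G.X_zero)
  ultimately obtain \<beta> u where u: "u \<in> gl r i" "u \<noteq> 0" "act hg u = sc \<beta> u"
    using G.exists_eigenvector assms(1) v by blast
  have "(act hg ^^ k) u = sc (\<beta> ^ k) u" for k
    by (induction k) (simp_all add: act_scale u glV mult.commute)
  then have "sc (\<alpha> ^ w - \<beta> ^ n) u = 0"
    using gn[of u] glV[OF u(1)] by (simp only: vs.scale_left_diff_distrib diff_self)
  then have "\<alpha> ^ w = \<beta> ^ n" using u(2) by simp
  moreover from this have "\<beta> \<noteq> 0"
    using assms(3) n_pos by (auto simp: power_0_left)
  ultimately show ?thesis using that u by blast
qed

end

section \<open>Simple modules: x acts as a scalar\<close>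

locale simple_yd_module = yd_module +
  assumes simple: "is_simple_YD sc V act \<delta>" and closed: "alg_closed TYPE('a)"
begin

lemma nontrivial: "V \<noteq> {0}"
  using simple by (simp add: is_simple_YD_def)

lemma sub_cases:
  assumes "W \<subseteq> V" "vs.subspace W" "\<And>h u. h \<in> Hcar \<Longrightarrow> u \<in> W \<Longrightarrow> act h u \<in> W"
    "\<And>u p. u \<in> W \<Longrightarrow> co u p \<in> W"
  shows "W = {0} \<or> W = V"
proof -
  have "is_YD_sub sc V act \<delta> W"
    using assms by (simp add: is_YD_sub_def co_def)
  then show ?thesis using simple by (auto simp: is_simple_YD_def)
qed

text \<open>All components of \<delta> v are multiples of v, so by compatibility those of \<delta>(h
  v) are combinations of vectors h_2 v. Hence the H-submodule generated by v is also a
  subcomodule.\<close>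

lemma cyclic:
  assumes "v \<in> gl r i" "v \<noteq> 0"
  shows "V = {act h v | h. h \<in> Hcar}"
proof -
  have v: "v \<in> V" "\<And>p. co v p = sc (Poly_Mapping.lookup (mono r i 0) p) v"
    using assms by (auto simp: gl_def)
  let ?W = "{act h v | h. h \<in> Hcar}"
  have sub: "vs.subspace ?W"
  proof (rule vs.subspaceI)
    show "0 \<in> ?W" using act_zero[OF v(1)] by (metis (mono_tags, lifting) Hcar_zero mem_Collect_eq)
  next
    fix x y assume "x \<in> ?W" "y \<in> ?W"
    then obtain a b where "x = act a v" "y = act b v" "a \<in> Hcar" "b \<in> Hcar" by auto
    then have "x + y = act (a + b) v" "a + b \<in> Hcar" using v by (simp_all add: act_add)
    then show "x + y \<in> ?W" by blast
  next
    fix c x assume "x \<in> ?W"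
    then obtain a where "x = act a v" "a \<in> Hcar" by auto
    then have "sc c x = act (psc c a) v" "psc c a \<in> Hcar" using v by (simp_all add: act_psc)
    then show "sc c x \<in> ?W" by blast
  qed
  have "act h (act a v) \<in> ?W" if "h \<in> Hcar" "a \<in> Hcar" for h a
    using that v act_hmul[of h a v] hmul_in_Hcar[of h a] by (metis (mono_tags, lifting) mem_Collect_eq)
  moreover have "co (act h v) p \<in> ?W" if h: "h \<in> Hcar" for h p
    unfolding co_act[OF h v(1)] v(2)
  proof (intro vs.subspace_sum[OF sub] vs.subspace_scale[OF sub])
    fix T b assume "T \<in> Poly_Mapping.keys (hDelta2 h)"
    then have car: "bas (fst (snd T)) \<in> Hcar" using hDelta2_valid by simp
    then have "act (bas (fst (snd T))) v \<in> ?W" by blast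
    then show "act (bas (fst (snd T))) (sc (Poly_Mapping.lookup (mono r i 0) b) v) \<in> ?W"
      unfolding act_scale[OF car v(1)] by (rule vs.subspace_scale[OF sub])
  qed
  moreover have "?W \<subseteq> V" using act_in v(1) by auto
  ultimately have "?W = {0} \<or> ?W = V"
    using sub by (intro sub_cases) auto
  moreover have "v \<in> ?W"
    using act_hone[OF v(1)] by (metis (mono_tags, lifting) gens_in_Hcar(4) mem_Collect_eq)
  ultimately show ?thesis using assms(2) by auto
qed

lemma x_scalar_of_eigenvector:
  assumes "u \<in> V" "u \<noteq> 0" "act hx u = sc \<alpha> u"
  shows "\<forall>v\<in>V. act hx v = sc \<alpha> v"
proof -
  let ?W = "{v \<in> V. act hx v = sc \<alpha> v}"
  have "?W = {0} \<or> ?W = V"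
  proof (rule sub_cases)
    show "vs.subspace ?W"
      by (rule vs.subspaceI)
        (auto simp: V_zero V_add V_scale act_vzero act_vadd act_scale vs.scale_right_distrib mult.commute)
    show "act h v \<in> ?W" if "h \<in> Hcar" "v \<in> ?W" for h v
      using that by (simp add: act_hx_commute act_in act_scale)
    show "co v p \<in> ?W" if "v \<in> ?W" for v p
      using that by (simp add: co_in co_act_x[symmetric] co_scale)
  qed auto
  then show ?thesis using assms by auto
qed

lemma x_scalar: "\<exists>\<alpha>. \<alpha> \<noteq> 0 \<and> (\<forall>v\<in>V. act hx v = sc \<alpha> v)"
proof -
  interpret X: operator_on sc V "act hx"
    by (rule operator_on_act) simp
  have inverse: "act (mono (- 1) 0 0) (act hx v) = v" if "v \<in> V" for v
    using that by (simp add: hx_def act_mono_mono act_mono_0)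
  have inj: "v = 0" if "v \<in> V" "act hx v = 0" for v
    using inverse[OF that(1)] that(2) act_vzero[of "mono (- 1) 0 0"] by simp
  have "\<exists>\<alpha> u. u \<in> V \<and> u \<noteq> 0 \<and> act hx u = sc \<alpha> u"
  proof (cases "\<forall>v\<in>V. \<exists>u\<in>V. v = act hx u - u")
    case False
    \<comment> \<open>The image of x - 1 is a proper submodule, hence zero, and x has eigenvalue
      1.\<close>
    let ?W = "(\<lambda>u. act hx u - u) ` V"
    have "?W = {0} \<or> ?W = V"
    proof (rule sub_cases)
      show "?W \<subseteq> V" using V_diff act_in by auto
      show "vs.subspace ?W"
      proof (rule vs.subspaceI)
        show "0 \<in> ?W" using V_zero by (force simp: act_vzero)
        show "x + y \<in> ?W" if "x \<in> ?W" "y \<in> ?W" for x y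
        proof -
          obtain u v where uv: "u \<in> V" "x = act hx u - u" "v \<in> V" "y = act hx v - v"
            using \<open>x \<in> ?W\<close> \<open>y \<in> ?W\<close> by auto
          then have "x + y = act hx (u + v) - (u + v)" by (simp add: act_vadd)
          with uv V_add show ?thesis by blast
        qed
        show "sc c x \<in> ?W" if "x \<in> ?W" for c x
          using that V_scale by (auto simp: act_scale vs.scale_right_diff_distrib intro!: image_eqI[of _ _ "sc _ _"])
      qed
      show "act h u \<in> ?W" if "h \<in> Hcar" "u \<in> ?W" for h u
      proof -
        obtain v where v: "v \<in> V" "u = act hx v - v" using \<open>u \<in> ?W\<close> by auto
        have "act h u = act hx (act h v) - act h v"
          using that(1) v by (simp add: act_vdiff act_in act_hx_commute)
        then show ?thesis using v(1) that(1) act_in by blast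
      qed
      show "co u p \<in> ?W" if "u \<in> ?W" for u p
      proof -
        obtain v where v: "v \<in> V" "u = act hx v - v" using \<open>u \<in> ?W\<close> by auto
        have "co u p = act hx (co v p) - co v p"
          using v by (simp add: co_diff co_act_x act_in)
        then show ?thesis using co_in[OF v(1)] by blast
      qed
    qed
    then have "?W = {0}" using False by auto
    then have "act hx v - v = 0" if "v \<in> V" for v
      using that by blast
    moreover obtain v where "v \<in> V" "v \<noteq> 0" using nontrivial V_zero by blast
    ultimately have "act hx v = sc 1 v" by simp
    with \<open>v \<in> V\<close> \<open>v \<noteq> 0\<close> show ?thesis by blast
  next
    case True
    obtain r i v where v: "v \<in> gl r i" "v \<noteq> 0"
      using exists_grouplike_vector nontrivial by blast
    have vV: "v \<in> V" using v(1) by (simp add: gl_def)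
    \<comment> \<open>By the PBW basis, the n^2 vectors g^i y^j v generate V over the Laurent
      polynomials in x.\<close>
    define I where "I = {..<n} \<times> {..<n}"
    define e where "e = (\<lambda>(i, j). act (mono 0 (int i) j) v)"
    have eV: "e p \<in> V" for p
      using vV by (cases p) (simp add: e_def act_in)
    \<comment> \<open>A power of x clears negative exponents. The claim covers all larger powers so
      that two summands can share the maximum of their bounds.\<close>
    have "\<exists>N. \<forall>N'\<ge>N. (act hx ^^ N') (act h v) \<in> X.gen I e" if "h \<in> Hcar" for h
      using that
    proof (induction rule: Hcar_induct)
      case zero
      have "(act hx ^^ N) 0 = 0" for N by (induction N) (simp_all add: act_vzero)
      then show ?case
        using vV X.gen_def by (auto simp: act_zero X.gen_def intro!: exI[of _ "\<lambda>_. 0"])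
    next
      case (bas c b)
      obtain a i j where b: "b = (a, i, j)" by (cases b)
      have ij: "(i, j) \<in> I" using bas by (simp add: b valid_def I_def)
      have "(act hx ^^ N) (act (psc c (bas b)) v) \<in> X.gen I e" if "N \<ge> nat (- a)" for N
      proof -
        have nat_a: "0 \<le> int N + a" using that by linarith
        have "(act hx ^^ N) (act (psc c (bas b)) v) = sc c (act (mono (int N + a) (int i) j) v)"
          using bas vV by (simp add: b bas_mono act_psc act_hx_pow act_in V_scale act_scale act_mono_mono)
        also have "act (mono (int N + a) (int i) j) v = (act hx ^^ nat (int N + a)) (e (i, j))"
          using vV nat_a by (simp add: e_def act_hx_pow act_in act_mono_mono)
        also have "sc c \<dots> = X.papp (smult c ([:0, 1:] ^ nat (int N + a))) (e (i, j))"
          using eV by (simp add: X.papp_smult X.papp_X_power)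
        also have "\<dots> \<in> X.gen I e"
          by (rule X.gen_base) (use ij in \<open>auto simp: I_def\<close>)
        finally show ?thesis .
      qed
      then show ?case by blast
    next
      case (add a b)
      then obtain N1 N2 where N: "\<And>N. N \<ge> N1 \<Longrightarrow> (act hx ^^ N) (act a v) \<in> X.gen I e"
        "\<And>N. N \<ge> N2 \<Longrightarrow> (act hx ^^ N) (act b v) \<in> X.gen I e" by blast
      have "(act hx ^^ N) (act (a + b) v) \<in> X.gen I e" if "N \<ge> max N1 N2" for N
      proof -
        have "(act hx ^^ N) (act (a + b) v) = (act hx ^^ N) (act a v) + (act hx ^^ N) (act b v)"
          using add vV by (simp add: act_add act_hx_pow V_add act_in act_vadd)
        also have "\<dots> \<in> X.gen I e"
          using N that eV by (intro X.gen_add) auto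
        finally show ?thesis .
      qed
      then show ?case by blast
    qed
    then have "\<exists>N. X.papp ([:0, 1:] ^ N * 1) u \<in> X.gen I e" if "u \<in> V" for u
      using that cyclic[OF v] by (auto simp: X.papp_X_power)
    \<comment> \<open>The elimination of generators starts from the multiplier 1.\<close>
    then obtain p where "p \<noteq> 0" "\<forall>v\<in>V. X.papp p v = 0"
      using X.torsion_of_finitely_generated[of I e 1] True inj eV by (auto simp: I_def)
    then show ?thesis
      using X.exists_eigenvector[OF closed _ vV v(2)] vV by blast
  qed
  then obtain \<alpha> u where u: "u \<in> V" "u \<noteq> 0" "act hx u = sc \<alpha> u" by blast
  then have "\<alpha> \<noteq> 0" using inj[OF u(1)] by auto
  with x_scalar_of_eigenvector[OF u] show ?thesis by blast
qed

end

section \<open>The modules \<open>V(\<alpha>,\<beta>,x\<^sup>r g\<^sup>i)\<close>\<close>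

context liu_algebra
begin

lemma Vcar_lookup: "f \<in> Vcar \<beta> i \<longleftrightarrow> (\<forall>k. mdim \<beta> i < k \<longrightarrow> Poly_Mapping.lookup f k = 0)"
  by (auto simp: Vcar_def in_keys_iff not_less[symmetric])

lemma Vcar_add: "f \<in> Vcar \<beta> i \<Longrightarrow> g \<in> Vcar \<beta> i \<Longrightarrow> f + g \<in> Vcar \<beta> i"
  and Vcar_psc: "f \<in> Vcar \<beta> i \<Longrightarrow> psc c f \<in> Vcar \<beta> i"
  and Vcar_zero: "0 \<in> Vcar \<beta> i"
  by (simp_all add: Vcar_lookup lookup_add)

lemma lookup_Gop: "Poly_Mapping.lookup (Gop \<beta> f) k = \<beta> * inverse \<gamma> ^ k * Poly_Mapping.lookup f k"
proof -
  have "Poly_Mapping.lookup (Gop \<beta> f) k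
      = (\<Sum>j\<in>Poly_Mapping.keys f. if j = k then \<beta> * inverse \<gamma> ^ k * Poly_Mapping.lookup f k else 0)"
    unfolding Gop_def lookup_sum by (rule sum.cong) (auto simp: lookup_single)
  then show ?thesis by (auto simp: in_keys_iff)
qed

lemma lookup_Yop:
  assumes "f \<in> Vcar \<beta> i"
  shows "Poly_Mapping.lookup (Yop \<beta> (mdim \<beta> i) f) k =
    (if k = 0 then (1 - \<beta> ^ n) * Poly_Mapping.lookup f (mdim \<beta> i)
     else if k \<le> mdim \<beta> i then Poly_Mapping.lookup f (k - 1) else 0)"
proof -
  let ?m = "mdim \<beta> i"
  have sub: "Poly_Mapping.keys f \<subseteq> {..?m}" using assms by (simp add: Vcar_def)
  have "Poly_Mapping.lookup (Yop \<beta> ?m f) k = (\<Sum>j\<in>Poly_Mapping.keys f.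
      if j < ?m then (if j + 1 = k then Poly_Mapping.lookup f j else 0)
      else (if k = 0 then (1 - \<beta> ^ n) * Poly_Mapping.lookup f j else 0))"
    unfolding Yop_def lookup_sum by (rule sum.cong) (auto simp: lookup_single when_def)
  also have "\<dots> = (\<Sum>j\<le>?m.
      if j < ?m then (if j + 1 = k then Poly_Mapping.lookup f j else 0)
      else (if k = 0 then (1 - \<beta> ^ n) * Poly_Mapping.lookup f j else 0))"
    using sub by (intro sum.mono_neutral_left) (auto simp: in_keys_iff)
  also have "\<dots> = (\<Sum>j<?m. if j + 1 = k then Poly_Mapping.lookup f j else 0)
      + (if k = 0 then (1 - \<beta> ^ n) * Poly_Mapping.lookup f ?m else 0)"
    by (simp add: lessThan_Suc_atMost[symmetric])
  also have "(\<Sum>j<?m. if j + 1 = k then Poly_Mapping.lookup f j else 0)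
      = (if 0 < k \<and> k \<le> ?m then Poly_Mapping.lookup f (k - 1) else 0)"
    by (cases k) auto
  finally show ?thesis by simp
qed

lemma Gop_in: "f \<in> Vcar \<beta> i \<Longrightarrow> Gop \<beta> f \<in> Vcar \<beta> i"
  by (simp add: Vcar_lookup lookup_Gop)

lemma Yop_in:
  assumes "f \<in> Vcar \<beta> i" shows "Yop \<beta> (mdim \<beta> i) f \<in> Vcar \<beta> i"
  unfolding Vcar_lookup lookup_Yop[OF assms] by auto

lemma lookup_Vdelta:
  assumes "f \<in> Vcar \<beta> i"
  shows "Poly_Mapping.lookup (Vdelta \<beta> r i f) p
    = (\<Sum>k\<le>mdim \<beta> i. \<Sum>l\<le>k. Poly_Mapping.single l (Poly_Mapping.lookup (cc \<beta> r i k l) p * Poly_Mapping.lookup f k))"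
  unfolding Vdelta_def lookup_sum
  using assms by (simp add: lookup_tensV) (intro sum.mono_neutral_left, auto simp: Vcar_def in_keys_iff)

lemma Vdelta_in:
  assumes "f \<in> Vcar \<beta> i" shows "Poly_Mapping.lookup (Vdelta \<beta> r i f) p \<in> Vcar \<beta> i"
  unfolding Vcar_lookup lookup_Vdelta[OF assms] lookup_sum
  by (auto simp: lookup_single when_def intro!: sum.neutral)

lemma Vact_add: "Vact \<alpha> \<beta> i (a + b) f = Vact \<alpha> \<beta> i a f + Vact \<alpha> \<beta> i b f"
  unfolding Vact_def
  by (subst sum_keys_add[where F = "\<lambda>b s. psc s (case b of (r', i', j') \<Rightarrow>
        Xop \<alpha> r' ((Gop \<beta> ^^ i') ((Yop \<beta> (mdim \<beta> i) ^^ j') f)))"])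
    (simp_all add: psc_add_left)

lemma Vact_psc_bas:
  "Vact \<alpha> \<beta> i (psc c (bas (r', i', j'))) f = psc c (Xop \<alpha> r' ((Gop \<beta> ^^ i') ((Yop \<beta> (mdim \<beta> i) ^^ j') f)))"
  by (cases "c = 0") (simp_all add: Vact_def bas_def)

end

text \<open>The explicit map goes from the model V' to V; closure of V' under the operations lets
  its inverse be evaluated on their results.\<close>

lemma (in Bnwg) YD_isomorphic_of_inverse:
  assumes bij: "bij_betw F V' V"
    and "\<And>u v. u \<in> V' \<Longrightarrow> v \<in> V' \<Longrightarrow> F (u + v) = F u + F v" "\<And>u v. u \<in> V' \<Longrightarrow> v \<in> V' \<Longrightarrow> u + v \<in> V'"
    and "\<And>c v. v \<in> V' \<Longrightarrow> F (sc' c v) = sc c (F v)" "\<And>c v. v \<in> V' \<Longrightarrow> sc' c v \<in> V'"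
    and "\<And>h v. h \<in> Hcar \<Longrightarrow> v \<in> V' \<Longrightarrow> F (act' h v) = act h (F v)" "\<And>h v. h \<in> Hcar \<Longrightarrow> v \<in> V' \<Longrightarrow> act' h v \<in> V'"
    and "\<And>p v. v \<in> V' \<Longrightarrow> F (Poly_Mapping.lookup (\<delta>' v) p) = Poly_Mapping.lookup (\<delta> (F v)) p"
      "\<And>p v. v \<in> V' \<Longrightarrow> Poly_Mapping.lookup (\<delta>' v) p \<in> V'"
    and "F 0 = 0" "0 \<in> V'"
  shows "YD_isomorphic sc V act \<delta> sc' V' act' \<delta>'"
proof -
  define f where "f = inv_into V' F"
  have inj: "inj_on F V'" and img: "F ` V' = V"
    using bij by (auto simp: bij_betw_def)
  have fF: "f (F v) = v" if "v \<in> V'" for v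
    using that inj by (simp add: f_def)
  have rep: "\<exists>v\<in>V'. u = F v" if "u \<in> V" for u
    using that img by auto
  have f0: "f 0 = 0" using fF[OF assms(11)] assms(10) by simp
  show ?thesis
    unfolding YD_isomorphic_def
  proof (intro exI[of _ f] conjI ballI allI)
    show "bij_betw f V V'" unfolding f_def by (rule bij_betw_inv_into[OF bij])
  next
    fix u v assume "u \<in> V" "v \<in> V"
    then obtain a b where "a \<in> V'" "u = F a" "b \<in> V'" "v = F b" using rep by blast
    then show "f (u + v) = f u + f v"
      using assms(2,3) fF by (metis (no_types))
  next
    fix c v assume "v \<in> V"
    then obtain b where "b \<in> V'" "v = F b" using rep by blast
    then show "f (sc c v) = sc' c (f v)" using assms(4,5) fF by metis
  next
    fix h v assume "h \<in> Hcar" "v \<in> V"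
    moreover from this obtain b where "b \<in> V'" "v = F b" using rep by blast
    ultimately show "f (act h v) = act' h (f v)" using assms(6,7) fF by metis
  next
    fix v assume "v \<in> V"
    then obtain b where b: "b \<in> V'" "v = F b" using rep by blast
    show "\<delta>' (f v) = pmapV f (\<delta> v)"
      by (rule poly_mapping_eqI) (simp add: b fF lookup_pmapV[of f, OF f0] assms(8)[symmetric] assms(9))
  qed
qed

section \<open>Simple modules\<close>

locale yd_eigenvector = yd_module n w \<gamma> sc V act \<delta>
  for n w :: nat and \<gamma> :: "'k::field" and sc :: "'k \<Rightarrow> 'v::ab_group_add \<Rightarrow> 'v" and V act \<delta> +
  fixes \<alpha> \<beta> :: 'k and r i :: int and v :: 'v
  assumes v_gl: "v \<in> gl r i" and v_nonzero: "v \<noteq> 0" and \<alpha>_nonzero: "\<alpha> \<noteq> 0" and \<beta>_nonzero: "\<beta> \<noteq> 0"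
    and x_act: "u \<in> V \<Longrightarrow> act hx u = sc \<alpha> u" and g_act: "act hg v = sc \<beta> v" and weight: "\<alpha> ^ w = \<beta> ^ n"
begin

text \<open>The future images of the basis vectors. Indices beyond m are kept, because the vanishing
  of the vector at m + 1 has to be proved.\<close>

definition vk :: "nat \<Rightarrow> 'v" where
  "vk k = (act hy ^^ k) v"

lemma v_in: "v \<in> V"
  using v_gl by (simp add: gl_def)

lemma vk_in [simp]: "vk k \<in> V"
  unfolding vk_def by (rule powers_in) (simp_all add: v_in)

lemma vk_Suc: "vk (Suc k) = act hy (vk k)" and vk_0: "vk 0 = v"
  by (simp_all add: vk_def)

lemma vk_mono: "vk k = act (mono 0 0 k) v"
  by (simp add: vk_def act_hy_pow v_in)

lemma g_vk: "act hg (vk k) = sc (\<beta> * inverse \<gamma> ^ k) (vk k)"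
  by (induction k) (simp_all add: vk_0 g_act vk_Suc act_hg_hy act_scale mult_ac)

lemma x_pow_act:
  assumes "u \<in> V" shows "act (mono a 0 0) u = sc (\<alpha> powi a) u"
proof -
  have nat: "act (mono (int k) 0 0) u = sc (\<alpha> ^ k) u" if "u \<in> V" for k u
    unfolding act_hx_pow[OF that, symmetric]
    by (induction k) (simp_all add: act_scale x_act that mult.commute)
  show ?thesis
  proof (cases "a \<ge> 0")
    case True
    then show ?thesis using nat[OF assms, of "nat a"] by (metis nat_0_le power_int_of_nat)
  next
    case False
    then obtain k where a: "a = - int k" by (metis le_cases nat_0_le neg_0_le_iff_le minus_minus)
    have "sc (\<alpha> ^ k) (act (mono a 0 0) u) = u"
      using nat[of "act (mono a 0 0) u" k] assms by (simp add: act_in act_mono_mono a act_mono_0)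
    then have "sc (inverse (\<alpha> ^ k)) u = act (mono a 0 0) u"
      using \<alpha>_nonzero by (metis vs.scale_scale left_inverse power_not_zero vs.scale_one)
    then show ?thesis by (simp add: a power_int_minus)
  qed
qed

text \<open>Here y^n = 1 - x^w acts as 1 - \<alpha>^w, which is 1 - \<beta>^n.\<close>

lemma y_pow_n: "u \<in> V \<Longrightarrow> act (mono 0 0 n) u = sc (1 - \<beta> ^ n) u"
proof -
  assume u: "u \<in> V"
  have "mono 0 0 n = mono 0 0 0 + psc (- 1) (mono (int w) 0 0)"
    using mono_shift_y[of 0 0 0] by (simp add: psc_minus)
  then have "act (mono 0 0 n) u = u + sc (- 1) (sc (\<alpha> powi int w) u)"
    using u by (simp add: act_add act_psc act_mono_0 x_pow_act)
  then show ?thesis by (simp add: weight vs.scale_left_diff_distrib)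
qed

lemma vk_shift_n: "vk (k + n) = sc (1 - \<beta> ^ n) (vk k)"
  using y_pow_n[of "vk k"] v_in by (simp add: vk_mono act_in act_mono_mono add.commute)

lemma co_vk:
  "k < n \<Longrightarrow> co (vk k) p = (\<Sum>l\<le>k. sc (Poly_Mapping.lookup (cc \<beta> r i k l) p) (vk l))"
proof (induction k arbitrary: p)
  case 0
  have "co v p = sc (Poly_Mapping.lookup (mono r i 0) p) v"
    using v_gl unfolding gl_def by blast
  then show ?case by (simp add: vk_0)
next
  case (Suc k)
  \<comment> \<open>A collects the two terms of \<open>co_act_y\<close> that stay at index l; B is
    the term that y moves to l + 1.\<close>
  define A where "A l = Poly_Mapping.lookup (hmul (cc \<beta> r i k l) Sy
      + psc (\<beta> * inverse \<gamma> ^ l) (hmul hy (hmul (cc \<beta> r i k l) Sg))) p" for l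
  define B where "B l = Poly_Mapping.lookup (hmul (cc \<beta> r i k l) Sg) p" for l
  have car: "cc \<beta> r i k l \<in> Hcar" if "l \<le> k" for l
    using that by (simp add: cc_eq)
  have "co (vk (Suc k)) p = (\<Sum>l\<le>k. sc (Poly_Mapping.lookup (hmul hy (hmul (cc \<beta> r i k l) Sg)) p) (act hg (vk l))
     + sc (Poly_Mapping.lookup (hmul (cc \<beta> r i k l) Sg) p) (act hy (vk l)) + sc (Poly_Mapping.lookup (hmul (cc \<beta> r i k l) Sy) p) (vk l))"
    unfolding vk_Suc by (rule co_act_y) (use Suc car in auto)
  also have "\<dots> = (\<Sum>l\<le>k. sc (A l) (vk l) + sc (B l) (vk (Suc l)))"
    by (rule sum.cong[OF refl])
      (simp add: A_def B_def g_vk vk_Suc lookup_add vs.scale_left_distrib mult_ac)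
  also have "\<dots> = (\<Sum>l\<le>Suc k. sc (if l \<le> k then A l else 0) (vk l))
      + (\<Sum>l\<le>Suc k. sc (if l = 0 then 0 else B (l - 1)) (vk l))"
    by (simp add: sum.distrib sum.atMost_Suc_shift[of "\<lambda>l. sc (if l = 0 then 0 else B (l - 1)) (vk l)"] del: sum.atMost_Suc)
      simp
  also have "\<dots> = (\<Sum>l\<le>Suc k. sc (Poly_Mapping.lookup (cc \<beta> r i (Suc k) l) p) (vk l))"
    unfolding sum.distrib[symmetric] vs.scale_left_distrib[symmetric]
    by (rule sum.cong[OF refl]) (auto simp: A_def B_def lookup_add le_Suc_eq)
  finally show ?case .
qed

text \<open>The vectors are eigenvectors of g and x, y moves along the chain, and
  \<open>co_vk\<close> expresses coactions by earlier vectors. Only the end of the chain needs an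
  assumption.\<close>

lemma chain_span_closed:
  assumes "M < n" "act hy (vk M) \<in> vs.span (vk ` {..M})"
  defines "W \<equiv> vs.span (vk ` {..M})"
  shows "W \<subseteq> V" "vs.subspace W" "\<And>h u. h \<in> Hcar \<Longrightarrow> u \<in> W \<Longrightarrow> act h u \<in> W"
    "\<And>u p. u \<in> W \<Longrightarrow> co u p \<in> W"
proof -
  have minimal: "W \<subseteq> S" if "vs.subspace S" "\<And>k. k \<le> M \<Longrightarrow> vk k \<in> S" for S
    unfolding W_def using that by (intro vs.span_minimal) auto
  have base: "vk k \<in> W" if "k \<le> M" for k
    unfolding W_def using that by (intro vs.span_base) auto
  show sub: "vs.subspace W" by (simp add: W_def)
  show WV: "W \<subseteq> V" by (rule minimal[OF subspace_V]) simp
  have "vk k \<in> {u \<in> V. act hg u \<in> W}" if "k \<le> M" for k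
    using that base by (simp add: g_vk vs.subspace_scale[OF sub])
  then have g: "W \<subseteq> {u \<in> V. act hg u \<in> W}"
    by (intro minimal subspace_act_preimage sub) auto
  have "vk k \<in> {u \<in> V. act hy u \<in> W}" if "k \<le> M" for k
    using that base[of "Suc k"] assms(2) vk_Suc[of k] by (cases "k = M") (auto simp: W_def)
  then have y: "W \<subseteq> {u \<in> V. act hy u \<in> W}"
    by (intro minimal subspace_act_preimage sub) auto
  show "act h u \<in> W" if "h \<in> Hcar" "u \<in> W" for h u
  proof (rule act_closed_of_generators[OF WV sub _ _ _ that])
    show "act (mono a 0 0) u \<in> W" if "u \<in> W" for a u
      using that WV by (auto simp: x_pow_act vs.subspace_scale[OF sub])
  qed (use g y in auto)
  show "co u p \<in> W" if "u \<in> W" for u p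
  proof -
    have "W \<subseteq> {u \<in> V. co u p \<in> W}"
    proof (rule minimal[OF subspace_co_preimage[OF sub]])
      show "vk k \<in> {u \<in> V. co u p \<in> W}" if "k \<le> M" for k
        using that assms(1) by (auto simp: co_vk intro!: vs.subspace_sum[OF sub] vs.subspace_scale[OF sub] base)
    qed
    then show ?thesis using that by auto
  qed
qed

text \<open>If v_(k+1) were zero, so would be its coaction. Its part of y-degree 1 comes from l = k
  alone, and there c(k+1,k) is nonzero, forcing v_k = 0.\<close>

lemma vk_nonzero: "k \<le> mdim \<beta> i \<Longrightarrow> vk k \<noteq> 0"
proof (induction k)
  case 0
  then show ?case by (simp add: vk_0 v_nonzero)
next
  case (Suc k)
  show ?case
  proof
    assume zero: "vk (Suc k) = 0"
    have k: "Suc k < n" using Suc.prems mdim_less[of \<beta> i] by simp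
    have "cc \<beta> r i (Suc k) k \<noteq> 0"
      using k Suc.prems by (intro cc_subdiag_nonzero beta_neq_of_less_mdim) auto
    then obtain p where p: "p \<in> Poly_Mapping.keys (cc \<beta> r i (Suc k) k)"
      by (metis keys_eq_empty ex_in_conv)
    have deg: "snd (snd p) = 1"
      using keys_cc[OF _ p] k by simp
    have "Poly_Mapping.lookup (cc \<beta> r i (Suc k) l) p = 0" if "l < k" for l
    proof (rule ccontr)
      assume "Poly_Mapping.lookup (cc \<beta> r i (Suc k) l) p \<noteq> 0"
      then have "snd (snd p) = (Suc k - l) mod n"
        using keys_cc[of l "Suc k" p] that by (simp add: in_keys_iff del: cc.simps)
      then show False using deg that k by simp
    qed
    then have "(\<Sum>l\<le>Suc k. sc (Poly_Mapping.lookup (cc \<beta> r i (Suc k) l) p) (vk l))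
        = (\<Sum>l\<le>Suc k. if l = k then sc (Poly_Mapping.lookup (cc \<beta> r i (Suc k) k) p) (vk k) else 0)"
      using zero by (intro sum.cong) (auto simp: le_Suc_eq simp del: cc.simps)
    then have "sc (Poly_Mapping.lookup (cc \<beta> r i (Suc k) k) p) (vk k) = 0"
      using co_vk[OF k, of p] zero co_zero by (simp del: cc.simps)
    then show False
      using p Suc by (simp add: in_keys_iff del: cc.simps)
  qed
qed

end

locale simple_yd_eigenvector = yd_eigenvector n w \<gamma> sc V act \<delta> \<alpha> \<beta> r i v + simple_yd_module n w \<gamma> sc V act \<delta>
  for n w :: nat and \<gamma> :: "'k::field" and sc :: "'k \<Rightarrow> 'v::ab_group_add \<Rightarrow> 'v" and V act \<delta> \<alpha> \<beta> r i v
begin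

lemma V_eq_span:
  assumes "M < n" "act hy (vk M) \<in> vs.span (vk ` {..M})"
  shows "V = vs.span (vk ` {..M})"
proof -
  have "vs.span (vk ` {..M}) = {0} \<or> vs.span (vk ` {..M}) = V"
    using chain_span_closed[OF assms] by (intro sub_cases)
  moreover have "vk 0 \<in> vs.span (vk ` {..M})"
    by (intro vs.span_base) auto
  ultimately show ?thesis
    using v_nonzero by (auto simp: vk_0)
qed

text \<open>Since y^n acts as a scalar, the chain closes at n - 1 for every admissible starting
  vector, whatever m is.\<close>

lemma V_eq_span_full: "V = vs.span (vk ` {..n - 1})"
proof (rule V_eq_span)
  have "act hy (vk (n - 1)) = sc (1 - \<beta> ^ n) (vk 0)"
    using vk_shift_n[of 0] n_pos by (simp flip: vk_Suc)
  also have "\<dots> \<in> vs.span (vk ` {..n - 1})"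
    by (intro vs.span_scale vs.span_base) auto
  finally show "act hy (vk (n - 1)) \<in> vs.span (vk ` {..n - 1})" .
qed (use n_pos in simp)

text \<open>If \<open>y\<^sup>m\<^sup>+\<^sup>1 v\<close> were nonzero it would be a grouplike eigenvector, hence generate \<open>V\<close>, although \<open>y\<close> is
  nilpotent.\<close>
lemma vk_Suc_mdim_eq_0:
  assumes "Suc (mdim \<beta> i) < n" "\<beta> = \<gamma> powi (int (mdim \<beta> i) - i)"
  shows "vk (Suc (mdim \<beta> i)) = 0" and "\<beta> ^ n = 1"
proof -
  show \<beta>n: "\<beta> ^ n = 1"
    by (subst assms(2)) (metis gamma_powi_n_mult mult.commute power_int_mult power_int_of_nat)
  show "vk (Suc (mdim \<beta> i)) = 0"
  proof (rule ccontr)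
    let ?m = "mdim \<beta> i"
    assume nz: "vk (Suc ?m) \<noteq> 0"
    have "co (vk (Suc ?m)) p = sc (Poly_Mapping.lookup (mono r (i - int (Suc ?m)) 0) p) (vk (Suc ?m))" for p
    proof -
      have "co (vk (Suc ?m)) p = (\<Sum>l\<le>Suc ?m. if l = Suc ?m then sc (Poly_Mapping.lookup (mono r (i - int (Suc ?m)) 0) p) (vk l) else 0)"
        unfolding co_vk[OF assms(1)]
        by (rule sum.cong[OF refl]) (use cc_eq_0[OF assms(2)] cc_self[of \<beta> r i "Suc ?m"] in \<open>auto simp: le_Suc_eq simp del: cc.simps\<close>)
      then show ?thesis by simp
    qed
    then have "vk (Suc ?m) \<in> gl r (i - int (Suc ?m))"
      by (simp add: gl_def)
    moreover have "(\<beta> * inverse \<gamma> ^ Suc ?m) ^ n = \<beta> ^ n"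
    proof -
      have "(inverse \<gamma> ^ Suc ?m) ^ n = (inverse (\<gamma> ^ n)) ^ Suc ?m"
        by (metis power_commutes power_inverse power_mult mult.commute)
      then show ?thesis by (simp add: power_mult_distrib gamma_pow_n)
    qed
    \<comment> \<open>Restart the chain at y^(m+1) v, a g-eigenvector with grouplike
      coaction.\<close>
    ultimately interpret U: simple_yd_eigenvector n w \<gamma> sc V act \<delta> \<alpha> "\<beta> * inverse \<gamma> ^ Suc ?m" r "i - int (Suc ?m)" "vk (Suc ?m)"
      using nz \<alpha>_nonzero \<beta>_nonzero x_act g_vk weight by unfold_locales auto
    have Uvk: "U.vk k = vk (k + Suc ?m)" for k
      unfolding U.vk_def by (simp only: vk_def funpow_add o_apply)
    have vkn: "vk n = 0"
      using vk_shift_n[of 0] by (simp add: \<beta>n)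
    define q where "q = (LEAST q. vk q = 0)"
    have q: "vk q = 0" unfolding q_def by (rule LeastI[of "\<lambda>q. vk q = 0", OF vkn])
    have "q \<noteq> 0" using q v_nonzero vk_0 by metis
    then obtain q' where q': "q = Suc q'" by (cases q) auto
    have nz': "vk q' \<noteq> 0"
      using not_less_Least[of q' "\<lambda>q. vk q = 0"] q' by (simp add: q_def)
    have vk_add: "vk (j + k) = act (mono 0 0 j) (vk k)" for j k
      by (simp add: vk_mono act_mono_mono v_in)
    have ge: "vk (j + q) = 0" for j
      unfolding vk_add q by (rule act_vzero) simp
    \<comment> \<open>V is spanned by vectors y^k v with k > m, and y^(q-1) kills these because y^q
      v = 0. So y^(q-1) v = 0, against minimality of q.\<close>
    have "vs.span (U.vk ` {..n - 1}) \<subseteq> {u \<in> V. act (mono 0 0 q') u \<in> {0}}"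
    proof (rule vs.span_minimal)
      show "vs.subspace {u \<in> V. act (mono 0 0 q') u \<in> {0}}"
        by (rule subspace_act_preimage) (simp_all add: vs.subspace_def)
      show "U.vk ` {..n - 1} \<subseteq> {u \<in> V. act (mono 0 0 q') u \<in> {0}}"
      proof -
        have "vk (q' + (k + Suc (mdim \<beta> i))) = 0" for k
          using ge[of "k + mdim \<beta> i"] by (simp add: q' add_ac)
        then show ?thesis by (auto simp: Uvk simp flip: vk_add)
      qed
    qed
    then have "act (mono 0 0 q') v = 0"
      using U.V_eq_span_full v_in by auto
    then show False
      using nz' by (simp add: vk_mono)
  qed
qed

text \<open>For m = n - 1 this is the scalar action of y^n. For smaller m both sides vanish, since
  \<beta> is then a power of \<gamma>.\<close>

lemma act_hy_top: "act hy (vk (mdim \<beta> i)) = sc (1 - \<beta> ^ n) v"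
proof (cases "mdim \<beta> i = n - 1")
  case True
  then show ?thesis
    using vk_shift_n[of 0] n_pos by (simp add: vk_0 flip: vk_Suc)
next
  case False
  then have "Suc (mdim \<beta> i) < n"
    using mdim_less[of \<beta> i] by linarith
  moreover have "\<beta> = \<gamma> powi (int (mdim \<beta> i) - i)"
    using False by (cases rule: mdim_cases[of \<beta> i]) auto
  ultimately show ?thesis
    using vk_Suc_mdim_eq_0 by (simp add: vk_Suc)
qed

section \<open>The explicit map from the model to V\<close>

definition F :: "(nat \<Rightarrow>\<^sub>0 'k) \<Rightarrow> 'v" where
  "F f = (\<Sum>k\<le>mdim \<beta> i. sc (Poly_Mapping.lookup f k) (vk k))"

lemma F_in [simp]: "F f \<in> V"
  by (simp add: F_def V_sum V_scale)

lemma F_add: "F (f + g) = F f + F g"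
  by (simp add: F_def lookup_add vs.scale_left_distrib sum.distrib)

lemma F_psc: "F (psc c f) = sc c (F f)"
  by (simp add: F_def vs.scale_sum_right)

lemma F_zero: "F 0 = 0"
  by (simp add: F_def)

lemma F_sum: "F (sum f A) = (\<Sum>x\<in>A. F (f x))"
  by (induction A rule: infinite_finite_induct) (simp_all add: F_zero F_add)

lemma F_single: "k \<le> mdim \<beta> i \<Longrightarrow> F (Poly_Mapping.single k c) = sc c (vk k)"
proof -
  assume k: "k \<le> mdim \<beta> i"
  have "F (Poly_Mapping.single k c) = (\<Sum>l\<le>mdim \<beta> i. if l = k then sc c (vk k) else 0)"
    unfolding F_def by (rule sum.cong) (auto simp: lookup_single)
  then show ?thesis using k by simp
qed

text \<open>Injectivity: the v_k with k <= m < n are nonzero and have distinct g-eigenvalues.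
  Surjectivity: their span is a nonzero submodule.\<close>

lemma bij_F: "bij_betw F (Vcar \<beta> i) V"
  unfolding bij_betw_def
proof
  interpret G: operator_on sc V "act hg"
    by (rule operator_on_act) simp
  have inj: "inj_on (\<lambda>k. \<beta> * inverse \<gamma> ^ k) {..mdim \<beta> i}"
  proof (rule inj_onI)
    fix k l assume kl: "k \<in> {..mdim \<beta> i}" "l \<in> {..mdim \<beta> i}" "\<beta> * inverse \<gamma> ^ k = \<beta> * inverse \<gamma> ^ l"
    then have "\<gamma> powi int k = \<gamma> powi int l"
      using \<beta>_nonzero by (simp add: power_inverse)
    then have dvd: "int n dvd int k - int l"
      by (simp only: gamma_powi_eq_iff)
    have "\<bar>int k - int l\<bar> < int n"
      using kl(1,2) mdim_less[of \<beta> i] by auto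
    then show "k = l"
      using dvd_imp_le_int[OF _ dvd] by fastforce
  qed
  show "inj_on F (Vcar \<beta> i)"
  proof (rule inj_onI)
    fix f g assume fg: "f \<in> Vcar \<beta> i" "g \<in> Vcar \<beta> i" "F f = F g"
    have "(\<Sum>k\<le>mdim \<beta> i. sc (Poly_Mapping.lookup f k - Poly_Mapping.lookup g k) (vk k)) = 0"
      using fg(3) by (simp add: F_def vs.scale_left_diff_distrib sum_subtractf)
    then have "sc (Poly_Mapping.lookup f k - Poly_Mapping.lookup g k) (vk k) = 0" if "k \<le> mdim \<beta> i" for k
      using G.eigenvectors_sum_eq_0[OF _ inj, of "\<lambda>k. sc (Poly_Mapping.lookup f k - Poly_Mapping.lookup g k) (vk k)" k] that
      by (simp add: V_scale act_scale g_vk mult.commute)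
    then have "Poly_Mapping.lookup f k = Poly_Mapping.lookup g k" for k
      using fg(1,2) vk_nonzero[of k] by (cases "k \<le> mdim \<beta> i") (auto simp: Vcar_lookup)
    then show "f = g" by (rule poly_mapping_eqI)
  qed
  have "V = vs.span (vk ` {..mdim \<beta> i})"
  proof (rule V_eq_span[OF mdim_less])
    have "sc (1 - \<beta> ^ n) (vk 0) \<in> vs.span (vk ` {..mdim \<beta> i})"
      by (intro vs.span_scale vs.span_base) auto
    then show "act hy (vk (mdim \<beta> i)) \<in> vs.span (vk ` {..mdim \<beta> i})"
      by (simp add: act_hy_top vk_0)
  qed
  also have "\<dots> \<subseteq> F ` Vcar \<beta> i"
  proof (rule vs.span_minimal)
    show "vk ` {..mdim \<beta> i} \<subseteq> F ` Vcar \<beta> i"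
    proof
      fix x assume "x \<in> vk ` {..mdim \<beta> i}"
      then obtain k where "k \<le> mdim \<beta> i" "x = F (Poly_Mapping.single k 1)"
        by (auto simp: F_single)
      then show "x \<in> F ` Vcar \<beta> i" by (auto simp: Vcar_def)
    qed
    show "vs.subspace (F ` Vcar \<beta> i)"
    proof (rule vs.subspaceI)
      show "0 \<in> F ` Vcar \<beta> i" using F_zero Vcar_zero by (metis imageI)
    next
      fix x y assume "x \<in> F ` Vcar \<beta> i" "y \<in> F ` Vcar \<beta> i"
      then obtain f g where "f \<in> Vcar \<beta> i" "g \<in> Vcar \<beta> i" "x + y = F (f + g)" by (auto simp: F_add)
      moreover from this have "f + g \<in> Vcar \<beta> i" by (simp add: Vcar_add)
      ultimately show "x + y \<in> F ` Vcar \<beta> i" by blast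
    next
      fix c x assume "x \<in> F ` Vcar \<beta> i"
      then obtain f where "f \<in> Vcar \<beta> i" "sc c x = F (psc c f)" by (auto simp: F_psc)
      moreover from this have "psc c f \<in> Vcar \<beta> i" by (simp add: Vcar_psc)
      ultimately show "sc c x \<in> F ` Vcar \<beta> i" by blast
    qed
  qed
  finally show "F ` Vcar \<beta> i = V" by auto
qed

lemma F_Gop: "F (Gop \<beta> f) = act hg (F f)"
  unfolding F_def by (simp add: act_vsum V_scale act_scale g_vk lookup_Gop mult_ac)

lemma F_Yop:
  assumes "f \<in> Vcar \<beta> i" shows "F (Yop \<beta> (mdim \<beta> i) f) = act hy (F f)"
proof -
  let ?m = "mdim \<beta> i"
  have "act hy (F f) = (\<Sum>k\<le>?m. sc (Poly_Mapping.lookup f k) (act hy (vk k)))"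
    unfolding F_def by (simp add: act_vsum V_scale act_scale)
  also have "\<dots> = (\<Sum>k<?m. sc (Poly_Mapping.lookup f k) (vk (Suc k))) + sc (Poly_Mapping.lookup f ?m * (1 - \<beta> ^ n)) v"
    by (simp add: lessThan_Suc_atMost[symmetric] act_hy_top vk_Suc)
  also have "\<dots> = F (Yop \<beta> ?m f)"
    unfolding F_def lookup_Yop[OF assms]
    by (simp add: sum.atMost_shift vk_0 mult.commute add.commute Suc_le_eq)
  finally show ?thesis by simp
qed

lemma F_Vact:
  assumes "h \<in> Hcar" "f \<in> Vcar \<beta> i"
  shows "F (Vact \<alpha> \<beta> i h f) = act h (F f)" and "Vact \<alpha> \<beta> i h f \<in> Vcar \<beta> i"
proof -
  \<comment> \<open>Membership is carried along because \<open>F_Yop\<close> holds only on the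
    carrier.\<close>
  have Y: "(Yop \<beta> (mdim \<beta> i) ^^ j) f \<in> Vcar \<beta> i \<and> F ((Yop \<beta> (mdim \<beta> i) ^^ j) f) = (act hy ^^ j) (F f)" for j
    using assms(2) by (induction j) (simp_all add: F_Yop Yop_in)
  have G: "(Gop \<beta> ^^ j) g \<in> Vcar \<beta> i \<and> F ((Gop \<beta> ^^ j) g) = (act hg ^^ j) (F g)" if "g \<in> Vcar \<beta> i" for j g
    using that by (induction j) (simp_all add: F_Gop Gop_in)
  have "F (Vact \<alpha> \<beta> i h f) = act h (F f) \<and> Vact \<alpha> \<beta> i h f \<in> Vcar \<beta> i"
    using assms(1)
  proof (induction rule: Hcar_induct)
    case zero
    then show ?case by (simp add: Vact_def F_zero act_zero Vcar_zero)
  next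
    case (bas c b)
    obtain a p q where b: "b = (a, p, q)" by (cases b)
    have "act (psc c (bas b)) (F f) = sc c (act (mono a 0 0) (act (mono 0 (int p) 0) (act (mono 0 0 q) (F f))))"
      using bas by (simp add: b bas_mono act_psc act_mono_split[of "F f" a "int p" q])
    also have "\<dots> = sc c (sc (\<alpha> powi a) ((act hg ^^ p) ((act hy ^^ q) (F f))))"
      by (simp add: x_pow_act act_in act_hg_pow act_hy_pow)
    finally show ?case
      using Y G by (simp add: b Vact_psc_bas Xop_def F_psc Vcar_psc)
  next
    case (add a b)
    then show ?case by (simp add: Vact_add F_add act_add Vcar_add)
  qed
  then show "F (Vact \<alpha> \<beta> i h f) = act h (F f)" "Vact \<alpha> \<beta> i h f \<in> Vcar \<beta> i" by auto
qed

lemma F_Vdelta: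
  assumes "f \<in> Vcar \<beta> i"
  shows "F (Poly_Mapping.lookup (Vdelta \<beta> r i f) p) = co (F f) p"
proof -
  have "co (F f) p = (\<Sum>k\<le>mdim \<beta> i. sc (Poly_Mapping.lookup f k) (co (vk k) p))"
    unfolding F_def by (simp add: co_sum V_scale co_scale)
  also have "\<dots> = (\<Sum>k\<le>mdim \<beta> i. \<Sum>l\<le>k. F (Poly_Mapping.single l (Poly_Mapping.lookup (cc \<beta> r i k l) p * Poly_Mapping.lookup f k)))"
    using mdim_less[of \<beta> i]
    by (intro sum.cong refl) (simp add: co_vk vs.scale_sum_right F_single mult.commute)
  finally show ?thesis
    by (simp add: lookup_Vdelta[OF assms] F_sum)
qed

lemma isomorphic_V: "YD_isomorphic sc V act \<delta> psc (Vcar \<beta> i) (Vact \<alpha> \<beta> i) (Vdelta \<beta> r i)"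
proof (rule YD_isomorphic_of_inverse[OF bij_F])
  show "F (Poly_Mapping.lookup (Vdelta \<beta> r i v) p) = Poly_Mapping.lookup (\<delta> (F v)) p" if "v \<in> Vcar \<beta> i" for p v
    using F_Vdelta[OF that] by (simp add: co_def)
qed (simp_all add: F_add F_psc F_zero F_Vact Vdelta_in Vcar_add Vcar_psc Vcar_zero)

end

lemma (in simple_yd_module) exists_isomorphic_V:
  "\<exists>\<alpha> \<beta> r i. \<alpha> \<noteq> 0 \<and> \<beta> \<noteq> 0 \<and> \<alpha> ^ w = \<beta> ^ n \<and>
    YD_isomorphic sc V act \<delta> psc (Vcar \<beta> i) (Vact \<alpha> \<beta> i) (Vdelta \<beta> r i)"
proof -
  obtain \<alpha> where \<alpha>: "\<alpha> \<noteq> 0" "\<And>u. u \<in> V \<Longrightarrow> act hx u = sc \<alpha> u"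
    using x_scalar by blast
  obtain r i v \<beta> where v: "v \<in> gl r i" "v \<noteq> 0" "act hg v = sc \<beta> v" "\<beta> \<noteq> 0" "\<alpha> ^ w = \<beta> ^ n"
    by (rule exists_gl_eigenvector[OF closed nontrivial \<alpha>])
  interpret simple_yd_eigenvector n w \<gamma> sc V act \<delta> \<alpha> \<beta> r i v
    by unfold_locales (use v \<alpha> in auto)
  show ?thesis using isomorphic_V v \<alpha>(1) by blast
qed

section \<open>Isomorphism classes\<close>

context liu_algebra
begin

lemma cc_cong: "(mono r i 0 :: 'k hel) = mono r' i' 0 \<Longrightarrow> cc \<beta> r i k = cc \<beta> r' i' k"
  by (induction k) auto

lemma mdim_cong:
  assumes "i mod int n = i' mod int n" shows "mdim \<beta> i = mdim \<beta> i'"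
proof -
  have "(- i - j) mod int n = (- i' - j) mod int n" for j
    using assms by (metis mod_diff_cong mod_minus_cong)
  then show ?thesis by (simp add: mdim_def phi_def)
qed

lemma mono_eq_mod:
  assumes "(mono r i 0 :: 'k hel) = mono r' i' 0" shows "i mod int n = i' mod int n"
proof -
  have "Poly_Mapping.keys (mono r i 0 :: 'k hel) = Poly_Mapping.keys (mono r' i' 0 :: 'k hel)"
    using assms by simp
  then have "nat (i mod int n) = nat (i' mod int n)"
    using n_pos by (simp add: mono_low bas_def)
  then show ?thesis
    using n_pos by (simp add: eq_nat_nat_iff)
qed

text \<open>Equal grouplikes can have different exponents, as in x^r g^(i+n) = x^(r+w) g^i. The
  coefficients depend only on the initial monomial and m only on i modulo n, so the two structures
  coincide and the identity map works.\<close>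

lemma isomorphic_of_eq:
  assumes "(mono r i 0 :: 'k hel) = mono r' i' 0"
  shows "YD_isomorphic psc (Vcar \<beta> i) (Vact \<alpha> \<beta> i) (Vdelta \<beta> r i) psc (Vcar \<beta> i') (Vact \<alpha> \<beta> i') (Vdelta \<beta> r' i')"
proof -
  have m: "mdim \<beta> i = mdim \<beta> i'"
    by (rule mdim_cong[OF mono_eq_mod[OF assms]])
  have "Vcar \<beta> i = Vcar \<beta> i'" "Vact \<alpha> \<beta> i = Vact \<alpha> \<beta> i'" "Vdelta \<beta> r i = Vdelta \<beta> r' i'"
    using m cc_cong[OF assms] by (auto simp: fun_eq_iff Vcar_def Vact_def Vdelta_def)
  moreover have "pmapV (\<lambda>x. x) t = t" for t :: "bidx \<Rightarrow>\<^sub>0 (nat \<Rightarrow>\<^sub>0 'k)"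
    by (rule poly_mapping_eqI) (simp add: lookup_pmapV)
  ultimately show ?thesis
    unfolding YD_isomorphic_def by (intro exI[of _ "\<lambda>x. x"]) (simp add: bij_betw_def)
qed

lemma lookup_lookup_Vdelta:
  assumes "f \<in> Vcar \<beta> i" "\<And>k. k > K \<Longrightarrow> Poly_Mapping.lookup f k = 0" "K \<le> mdim \<beta> i"
  shows "Poly_Mapping.lookup (Poly_Mapping.lookup (Vdelta \<beta> r i f) p) l
     = (\<Sum>k\<in>{l..K}. Poly_Mapping.lookup (cc \<beta> r i k l) p * Poly_Mapping.lookup f k)"
proof -
  have "Poly_Mapping.lookup (Poly_Mapping.lookup (Vdelta \<beta> r i f) p) l
     = (\<Sum>k\<le>mdim \<beta> i. if l \<le> k then Poly_Mapping.lookup (cc \<beta> r i k l) p * Poly_Mapping.lookup f k else 0)"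
    unfolding lookup_Vdelta[OF assms(1)] lookup_sum
    by (rule sum.cong[OF refl]) (simp add: lookup_single when_def)
  also have "\<dots> = (\<Sum>k\<in>{l..K}. if l \<le> k then Poly_Mapping.lookup (cc \<beta> r i k l) p * Poly_Mapping.lookup f k else 0)"
    by (rule sum.mono_neutral_right) (use assms(2,3) in \<open>auto simp: not_le\<close>)
  finally show ?thesis by simp
qed

lemma Vact_hx: "Vact \<alpha> \<beta> i hx f = psc \<alpha> f"
proof -
  have "hx = psc 1 (bas (1, 0, 0))" using n_pos by (simp add: hx_def mono_low)
  then show ?thesis by (simp only: Vact_psc_bas) (simp add: Xop_def)
qed

lemma Vact_hg: "1 < n \<Longrightarrow> Vact \<alpha> \<beta> i hg f = Gop \<beta> f"
proof -
  assume "1 < n"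
  then have "hg = psc 1 (bas (0, 1, 0))" by (simp add: hg_def mono_low)
  then show ?thesis by (simp only: Vact_psc_bas) (simp add: Xop_def)
qed

text \<open>The image \<open>u\<close> of \<open>v\<^sub>0\<close> has coaction \<open>x\<^sup>r g\<^sup>i \<otimes> u\<close>; since the coefficients \<open>c(K,K-1)\<close> do not
  vanish for \<open>0 < K \<le> m\<close>, this forces \<open>u\<close> to be a multiple of \<open>v\<^sub>0\<close>.\<close>
lemma grouplike_in_V:
  assumes u: "u \<in> Vcar \<beta> i" "u \<noteq> 0"
    and gl: "\<And>p. Poly_Mapping.lookup (Vdelta \<beta> r i u) p = psc (Poly_Mapping.lookup (mono s j 0) p) u"
  shows "mono r i 0 = (mono s j 0 :: 'k hel)" and "\<exists>c. u = Poly_Mapping.single 0 c"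
proof -
  define K where "K = Max (Poly_Mapping.keys u)"
  have ne: "Poly_Mapping.keys u \<noteq> {}" using u(2) by simp
  have K: "Poly_Mapping.lookup u K \<noteq> 0"
    using Max_in[OF _ ne] by (simp add: K_def in_keys_iff)
  have above: "Poly_Mapping.lookup u k = 0" if "k > K" for k
    using that unfolding K_def by (metis Max_ge finite_keys in_keys_iff not_less)
  have Km: "K \<le> mdim \<beta> i"
    using K u(1) by (auto simp: Vcar_lookup not_le[symmetric])
  have eq: "(\<Sum>k\<in>{l..K}. Poly_Mapping.lookup (cc \<beta> r i k l) p * Poly_Mapping.lookup u k)
      = Poly_Mapping.lookup (mono s j 0) p * Poly_Mapping.lookup u l" for l p
    using lookup_lookup_Vdelta[OF u(1) above Km, of r p l] gl by simp
  \<comment> \<open>At v_K only k = K contributes, with coefficient c(K,K) = x^r g^(i-K).\<close>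
  have diag: "mono r (i - int K) 0 = (mono s j 0 :: 'k hel)"
    using eq[of K] K by (intro poly_mapping_eqI) (simp add: cc_self)
  have "K = 0"
  proof (cases K)
    case (Suc k)
    \<comment> \<open>For K = k + 1, compare the coefficients of v_k at an index of y-degree 1:
      neither c(k,k) nor x^s g^j has such a term, so c(K,k) alone would have to vanish
      there.\<close>
    have "cc \<beta> r i K k \<noteq> 0"
      unfolding Suc using Suc Km mdim_less[of \<beta> i] by (intro cc_subdiag_nonzero beta_neq_of_less_mdim) auto
    then obtain p where p: "p \<in> Poly_Mapping.keys (cc \<beta> r i K k)"
      by (metis keys_eq_empty ex_in_conv)
    have deg: "snd (snd p) = 1"
      using keys_cc[OF _ p] Suc Km mdim_less[of \<beta> i] by simp
    have low: "Poly_Mapping.lookup (mono a b 0 :: 'k hel) p = 0" for a b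
      using keys_mono[of p a b 0] deg by (auto simp: in_keys_iff)
    have "{k..K} = {k, K}" using Suc by auto
    then have "Poly_Mapping.lookup (cc \<beta> r i K k) p * Poly_Mapping.lookup u K = 0"
      using eq[of k p] Suc by (simp add: low cc_self del: cc.simps)
    then show ?thesis using K p by (simp add: in_keys_iff)
  qed
  then show "mono r i 0 = (mono s j 0 :: 'k hel)" using diag by simp
  have "u = Poly_Mapping.single 0 (Poly_Mapping.lookup u 0)"
    using above \<open>K = 0\<close> by (intro poly_mapping_eqI) (auto simp: lookup_single when_def)
  then show "\<exists>c. u = Poly_Mapping.single 0 c" by blast
qed

text \<open>The image of v_0 is grouplike, hence a multiple of the other v_0 with the same grouplike
  element; comparing the actions of x and g on it gives the scalars.\<close>

lemma parameters_of_isomorphic: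
  assumes iso: "YD_isomorphic psc (Vcar \<beta> i) (Vact \<alpha> \<beta> i) (Vdelta \<beta> r i) psc (Vcar \<beta>' i') (Vact \<alpha>' \<beta>' i') (Vdelta \<beta>' r' i')"
    and weight: "\<alpha> ^ w = \<beta> ^ n" "\<alpha>' ^ w = \<beta>' ^ n"
  shows "\<alpha> = \<alpha>' \<and> \<beta> = \<beta>' \<and> mono r i 0 = (mono r' i' 0 :: 'k hel)"
proof -
  obtain f where f: "bij_betw f (Vcar \<beta> i) (Vcar \<beta>' i')"
    "\<And>c v. v \<in> Vcar \<beta> i \<Longrightarrow> f (psc c v) = psc c (f v)"
    "\<And>h v. h \<in> Hcar \<Longrightarrow> v \<in> Vcar \<beta> i \<Longrightarrow> f (Vact \<alpha> \<beta> i h v) = Vact \<alpha>' \<beta>' i' h (f v)"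
    "\<And>v. v \<in> Vcar \<beta> i \<Longrightarrow> Vdelta \<beta>' r' i' (f v) = pmapV f (Vdelta \<beta> r i v)"
    using iso unfolding YD_isomorphic_def by blast
  define e where "e = (Poly_Mapping.single 0 1 :: nat \<Rightarrow>\<^sub>0 'k)"
  have e: "e \<in> Vcar \<beta> i" "0 \<in> Vcar \<beta> i"
    by (simp_all add: e_def Vcar_def)
  have f0: "f 0 = 0" using f(2)[OF e(2), of 0] by simp
  have u: "f e \<in> Vcar \<beta>' i'" "f e \<noteq> 0"
    using bij_betwE[OF f(1)] e f0 inj_onD[OF bij_betw_imp_inj_on[OF f(1)], of e 0]
    by (auto simp: e_def)
  have psc_inj: "c = d" if "psc c (f e) = psc d (f e)" for c d
  proof -
    obtain k where "Poly_Mapping.lookup (f e) k \<noteq> 0" using u(2) by (metis poly_mapping_eqI lookup_zero)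
    then show ?thesis using arg_cong[OF that, of "\<lambda>t. Poly_Mapping.lookup t k"] by simp
  qed
  have \<alpha>: "\<alpha> = \<alpha>'"
    using f(3)[of hx e] f(2)[OF e(1), of \<alpha>] e by (intro psc_inj) (simp add: Vact_hx, simp add: hx_def)
  have "Poly_Mapping.lookup (Vdelta \<beta>' r' i' (f e)) p = psc (Poly_Mapping.lookup (mono r i 0) p) (f e)" for p
  proof -
    have "Poly_Mapping.lookup (Vdelta \<beta> r i e) p = psc (Poly_Mapping.lookup (mono r i 0) p) e"
      by (simp add: Vdelta_def e_def lookup_tensV)
    then show ?thesis
      using f(2)[OF e(1)] by (simp add: f(4)[OF e(1)] lookup_pmapV[of f, OF f0])
  qed
  from grouplike_in_V[OF u this] obtain c where c: "f e = Poly_Mapping.single 0 c"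
    and mono: "mono r' i' 0 = (mono r i 0 :: 'k hel)" by blast
  have "\<beta> = \<beta>'"
  proof (cases "n = 1")
    \<comment> \<open>For n = 1 the index (0,1,0) of g is not valid; the weight conditions then read
      \<beta> = \<alpha>^w and determine \<beta>.\<close>
    case True
    then show ?thesis using weight \<alpha> by simp
  next
    case False
    then have n: "1 < n" using n_pos by simp
    have G: "Gop b (Poly_Mapping.single 0 d) = psc b (Poly_Mapping.single 0 d)" for b d :: 'k
      by (rule poly_mapping_eqI) (simp add: lookup_Gop lookup_single when_def)
    have "hg \<in> Hcar" by (simp add: hg_def)
    then have "f (Gop \<beta> e) = Gop \<beta>' (f e)"
      using f(3)[OF _ e(1), of hg] by (simp add: Vact_hg[OF n])
    moreover have "Gop \<beta> e = psc \<beta> e" "Gop \<beta>' (f e) = psc \<beta>' (f e)"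
      unfolding c unfolding e_def by (rule G)+
    ultimately have "psc \<beta> (f e) = psc \<beta>' (f e)"
      using f(2)[OF e(1), of \<beta>] by simp
    then show ?thesis by (rule psc_inj)
  qed
  with \<alpha> mono show ?thesis by simp
qed

end

theorem theorem4p3:
  fixes n w :: nat and \<gamma> :: "'k::field_char_0"
  assumes "alg_closed TYPE('k)" and "0 < n" and "0 < w" and "primitive_root n \<gamma>"
  shows "(\<forall>(sc :: 'k \<Rightarrow> 'v::ab_group_add \<Rightarrow> 'v) V act \<delta>.
            Bnwg.is_simple_YD n w \<gamma> sc V act \<delta> \<longrightarrow>
            (\<exists>\<alpha> \<beta> r i. \<alpha> \<noteq> 0 \<and> \<beta> \<noteq> 0 \<and> \<alpha> ^ w = \<beta> ^ n \<and>
               Bnwg.YD_isomorphic n sc V act \<delta>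
                 psc (Bnwg.Vcar n \<gamma> \<beta> i) (Bnwg.Vact n \<gamma> \<alpha> \<beta> i) (Bnwg.Vdelta n w \<gamma> \<beta> r i)))
       \<and> (\<forall>\<alpha> \<beta> r i \<alpha>' \<beta>' r' i'.
            \<alpha> \<noteq> 0 \<and> \<beta> \<noteq> 0 \<and> \<alpha> ^ w = \<beta> ^ n \<and> \<alpha>' \<noteq> 0 \<and> \<beta>' \<noteq> 0 \<and> \<alpha>' ^ w = \<beta>' ^ n \<longrightarrow>
            (Bnwg.YD_isomorphic n
               psc (Bnwg.Vcar n \<gamma> \<beta> i) (Bnwg.Vact n \<gamma> \<alpha> \<beta> i) (Bnwg.Vdelta n w \<gamma> \<beta> r i)
               psc (Bnwg.Vcar n \<gamma> \<beta>' i') (Bnwg.Vact n \<gamma> \<alpha>' \<beta>' i') (Bnwg.Vdelta n w \<gamma> \<beta>' r' i')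
             \<longleftrightarrow> \<alpha> = \<alpha>' \<and> \<beta> = \<beta>' \<and> Bnwg.mono n w r i 0 = (Bnwg.mono n w r' i' 0 :: 'k hel)))"
proof -
  interpret liu_algebra n w \<gamma>
    by unfold_locales (use assms in auto)
  show ?thesis
  proof (intro conjI allI impI)
    fix sc :: "'k \<Rightarrow> 'v \<Rightarrow> 'v" and V act \<delta>
    assume simple: "is_simple_YD sc V act \<delta>"
    then interpret simple_yd_module n w \<gamma> sc V act \<delta>
      by unfold_locales (use assms in \<open>auto simp: is_simple_YD_def\<close>)
    show "\<exists>\<alpha> \<beta> r i. \<alpha> \<noteq> 0 \<and> \<beta> \<noteq> 0 \<and> \<alpha> ^ w = \<beta> ^ n \<and>
        YD_isomorphic sc V act \<delta> psc (Vcar \<beta> i) (Vact \<alpha> \<beta> i) (Vdelta \<beta> r i)"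
      by (rule exists_isomorphic_V)
  next
    fix \<alpha> \<beta> :: 'k and r i :: int and \<alpha>' \<beta>' :: 'k and r' i' :: int
    assume *: "\<alpha> \<noteq> 0 \<and> \<beta> \<noteq> 0 \<and> \<alpha> ^ w = \<beta> ^ n \<and> \<alpha>' \<noteq> 0 \<and> \<beta>' \<noteq> 0 \<and> \<alpha>' ^ w = \<beta>' ^ n"
    show "YD_isomorphic psc (Vcar \<beta> i) (Vact \<alpha> \<beta> i) (Vdelta \<beta> r i) psc (Vcar \<beta>' i') (Vact \<alpha>' \<beta>' i') (Vdelta \<beta>' r' i')
      \<longleftrightarrow> \<alpha> = \<alpha>' \<and> \<beta> = \<beta>' \<and> mono r i 0 = (mono r' i' 0 :: 'k hel)"
      using parameters_of_isomorphic isomorphic_of_eq * by metis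
  qed
qed

end
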